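(* Uniform polyhedra are uniform ANRs. That is, if $P$ is a countable conditionally complete poset, then its geometric realization $|P|$ is a uniform ANR: whenever $|P|$ is uniformly embedded as a closed subset of a metrizable uniform space $X$, there is a uniformly continuous retraction of some uniform neighborhood of $|P|$ in $X$ onto $|P|$.
   Context: A poset is conditionally complete if every nonempty subset that has an upper bound has a least upper bound. Geometric realization: for a poset $P$, let $[0,1]^P$ be the set of all functions $P\to[0,1]$ with the metric $d(f,g)=\sup_{s\in P}|f(s)-g(s)|$. Each $p\in P$ is identified with the characteristic function of $\{q\in P: q\le p\}$. Then $|P|\subset[0,1]^P$ is the union of the convex hulls of all nonempty finite chains of $P$, with the metric $d$ and the induced uniformity. A uniform polyhedron is the geometric realization of a countable conditionally complete poset. A uniform neighborhood of a subset $A$ of a metric space $X$ is a subset of $X$ containing the $\varepsilon$-neighborhood of $A$ for some $\varepsilon>0$. A uniform embedding is a uniform homeomorphism onto its image. A metrizable uniform space is a uniform space whose uniformity is induced by a metric. *)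

theory Defs
  imports "HOL-Analysis.Analysis"
begin

definition conditionally_complete_on :: "'a set \<Rightarrow> 'a rel \<Rightarrow> bool" where
  "conditionally_complete_on P r \<longleftrightarrow>
     (\<forall>S. S \<subseteq> P \<and> S \<noteq> {} \<and> (\<exists>u\<in>P. \<forall>s\<in>S. (s, u) \<in> r) \<longrightarrow>
        (\<exists>l\<in>P. (\<forall>s\<in>S. (s, l) \<in> r) \<and> (\<forall>u\<in>P. (\<forall>s\<in>S. (s, u) \<in> r) \<longrightarrow> (l, u) \<in> r)))"

(* Functions from P to [0,1] are represented, as in funspace, by extensional functions:
   they take the value undefined outside P. *)

definition unit_funspace :: "'a set \<Rightarrow> ('a \<Rightarrow> real) metric" where
  "unit_funspace P = funspace P (submetric euclidean_metric {0..1})"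

definition poset_vertex :: "'a set \<Rightarrow> 'a rel \<Rightarrow> 'a \<Rightarrow> 'a \<Rightarrow> real" where
  "poset_vertex P r p = restrict (indicator {q \<in> P. (q, p) \<in> r}) P"

(* The convex hull of a finite set F of functions on P, as the set of convex combinations.
   The library's hull is not available because the function type is not a real vector space. *)
definition fun_convex_hull :: "'a set \<Rightarrow> ('a \<Rightarrow> real) set \<Rightarrow> ('a \<Rightarrow> real) set" where
  "fun_convex_hull P F =
     {\<lambda>s\<in>P. \<Sum>f\<in>F. w f * f s | w. (\<forall>f\<in>F. 0 \<le> w f) \<and> sum w F = 1}"

definition realization_points :: "'a set \<Rightarrow> 'a rel \<Rightarrow> ('a \<Rightarrow> real) set" where
  "realization_points P r =
     (\<Union>C\<in>{C. C \<subseteq> P \<and> C \<noteq> {} \<and> finite C \<and> C \<in> Chains r}. fun_convex_hull P (poset_vertex P r ` C))"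

definition geometric_realization :: "'a set \<Rightarrow> 'a rel \<Rightarrow> ('a \<Rightarrow> real) metric" where
  "geometric_realization P r = submetric (unit_funspace P) (realization_points P r)"

lemma mspace_unit_funspace: "mspace (unit_funspace P) = (P \<rightarrow>\<^sub>E {0..1})"
proof -
  interpret Metric_space "{0..1::real}" dist
    by (metis Met_TC.subspace top_greatest)
  have "mbounded (f ` P)" if "f ` P \<subseteq> {0..1}" for f :: "'a \<Rightarrow> real"
    unfolding mbounded_def mcball_def
    using that by (intro exI[of _ 0] exI[of _ 1]) (force simp: dist_real_def)
  then show ?thesis
    by (simp add: unit_funspace_def fspace_def PiE_def image_subset_iff_funcset set_eq_iff) blast
qed

lemma mdist_unit_funspace:
  assumes "f \<in> P \<rightarrow>\<^sub>E {0..1}" "g \<in> P \<rightarrow>\<^sub>E {0..1}" "P \<noteq> {}"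
  shows "mdist (unit_funspace P) f g = (SUP s\<in>P. \<bar>f s - g s\<bar>)"
proof -
  interpret Metric_space "{0..1::real}" dist
    by (metis Met_TC.subspace top_greatest)
  show ?thesis
    using assms mspace_unit_funspace[of P]
    by (simp add: unit_funspace_def fdist_def dist_real_def)
qed

lemma mspace_geometric_realization: "mspace (geometric_realization P r) = realization_points P r"
proof -
  have "(\<lambda>s\<in>P. \<Sum>f\<in>F. w f * f s) \<in> P \<rightarrow>\<^sub>E {0..1}"
    if F: "F = poset_vertex P r ` C" and w: "\<forall>f\<in>F. 0 \<le> w f" "sum w F = 1" for F C w
  proof -
    have "0 \<le> (\<Sum>f\<in>F. w f * f s) \<and> (\<Sum>f\<in>F. w f * f s) \<le> 1" if "s \<in> P" for s
    proof -
      have b: "0 \<le> f s" "f s \<le> 1" if "f \<in> F" for f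
        using that \<open>s \<in> P\<close> by (auto simp: F poset_vertex_def indicator_def)
      have "(\<Sum>f\<in>F. w f * f s) \<le> sum w F"
        using b w(1) by (intro sum_mono) (simp add: mult_left_le)
      then show ?thesis
        using b w by (simp add: sum_nonneg)
    qed
    then show ?thesis by auto
  qed
  then have "realization_points P r \<subseteq> P \<rightarrow>\<^sub>E {0..1}"
    unfolding realization_points_def fun_convex_hull_def by blast
  then show ?thesis
    by (auto simp: geometric_realization_def mspace_unit_funspace)
qed

definition uniform_neighborhood :: "'x metric \<Rightarrow> 'x set \<Rightarrow> 'x set \<Rightarrow> bool" where
  "uniform_neighborhood X A N \<longleftrightarrow>
     N \<subseteq> mspace X \<and>
     (\<exists>\<epsilon>>0. \<forall>x\<in>mspace X. (\<exists>a\<in>A. mdist X a x < \<epsilon>) \<longrightarrow> x \<in> N)"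

definition uniform_homeomorphism :: "'a metric \<Rightarrow> 'b metric \<Rightarrow> ('a \<Rightarrow> 'b) \<Rightarrow> bool" where
  "uniform_homeomorphism Y Z f \<longleftrightarrow>
     uniformly_continuous_map Y Z f \<and>
     (\<exists>g. uniformly_continuous_map Z Y g \<and>
        (\<forall>y\<in>mspace Y. g (f y) = y) \<and> (\<forall>z\<in>mspace Z. f (g z) = z))"

definition uniform_embedding :: "'a metric \<Rightarrow> 'x metric \<Rightarrow> ('a \<Rightarrow> 'x) \<Rightarrow> bool" where
  "uniform_embedding Y X e \<longleftrightarrow>
     e ` mspace Y \<subseteq> mspace X \<and> uniform_homeomorphism Y (submetric X (e ` mspace Y)) e"

definition uniform_retraction :: "'x metric \<Rightarrow> 'x set \<Rightarrow> 'x set \<Rightarrow> ('x \<Rightarrow> 'x) \<Rightarrow> bool" where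
  "uniform_retraction X N A \<rho> \<longleftrightarrow>
     A \<subseteq> N \<and> uniformly_continuous_map (submetric X N) (submetric X A) \<rho> \<and> (\<forall>a\<in>A. \<rho> a = a)"

(* A metrizable uniform space is given by any metric inducing its uniformity; all notions
   used here depend on the metric only through that uniformity.  A definition cannot quantify
   over types, so the type of points of the ambient space X is a parameter; leaving it
   as a free type variable in a theorem amounts to quantifying over all X. *)
definition uniform_ANR :: "'x itself \<Rightarrow> 'a metric \<Rightarrow> bool" where
  "uniform_ANR (_ :: 'x itself) Y \<longleftrightarrow>
     (\<forall>(X :: 'x metric) e.
        uniform_embedding Y X e \<and> closedin (mtopology_of X) (e ` mspace Y) \<longrightarrow>
        (\<exists>N \<rho>. uniform_neighborhood X (e ` mspace Y) N \<and> uniform_retraction X N (e ` mspace Y) \<rho>))"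

end

theory Submission
  imports Defs
begin

text \<open>A function \<open>P \<rightarrow> [0,1]\<close> with finite image lies in the realization iff its superlevel sets at the
  levels in \<open>(0,1]\<close> are principal ideals. Hence a function with finite image whose superlevel sets
  at these levels are merely nonempty and bounded above can be pushed into the realization by
  replacing each superlevel set with the ideal below its supremum; this operation is nonexpansive
  for the sup metric and fixes the realization.

  It remains to extend \<open>e\<inverse>\<close> to such functions near the image \<open>A\<close> of the embedding \<open>e\<close>. After
  replacing the metric by a concave modulus of it, \<open>e\<inverse>\<close> is 1-Lipschitz. At distance \<open>D\<close> from \<open>A\<close>
  we take a maximum of \<open>e\<inverse>(a\<^sub>i)\<close> minus a penalty, where \<open>a\<^sub>0, a\<^sub>1, \<dots>\<close> is dense in \<open>A\<close> and the
  penalty is at least 1 unless \<open>a\<^sub>i\<close> is at distance of the order \<open>D\<close> and no earlier \<open>a\<^sub>j\<close> is closer.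
  So only finitely many \<open>i\<close> contribute and the image stays finite. The penalties vary with
  slope of the order \<open>1/D\<close>, but the maximum is uniformly continuous, because it is also within \<open>O(D)\<close>
  of a nearby value of \<open>e\<inverse>\<close>.\<close>

subsection \<open>Points of the realization\<close>

definition superlevel :: "'a set \<Rightarrow> ('a \<Rightarrow> real) \<Rightarrow> real \<Rightarrow> 'a set" where
  "superlevel P u t = {s \<in> P. t \<le> u s}"

locale partial_order_set =
  fixes P :: "'a set" and r :: "'a rel"
  assumes partial_order: "partial_order_on P r"
begin

section \<open>Order-theoretic preliminaries\<close>

definition down :: "'a \<Rightarrow> 'a set" where
  "down p = {s \<in> P. (s, p) \<in> r}"

lemma order_refl: "p \<in> P \<Longrightarrow> (p, p) \<in> r"
  using partial_order by (auto simp: order_on_defs refl_on_def)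

lemma order_trans: "(p, q) \<in> r \<Longrightarrow> (q, s) \<in> r \<Longrightarrow> (p, s) \<in> r"
  using partial_order by (auto simp: order_on_defs dest: transD)

lemma order_antisym: "(p, q) \<in> r \<Longrightarrow> (q, p) \<in> r \<Longrightarrow> p = q"
  using partial_order by (auto simp: order_on_defs dest: antisymD)

lemma finite_chain_has_max:
  assumes "finite C" "C \<noteq> {}" "C \<subseteq> P" "C \<in> Chains r"
  shows "\<exists>p\<in>C. \<forall>q\<in>C. (q, p) \<in> r"
  using assms
proof (induction C rule: finite_ne_induct)
  case (singleton x)
  then show ?case using order_refl by auto
next
  case (insert x C)
  then obtain p where p: "p \<in> C" "\<forall>q\<in>C. (q, p) \<in> r"
    by (auto simp: Chains_def)
  have "(x, p) \<in> r \<or> (p, x) \<in> r"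
    using insert.prems p by (auto simp: Chains_def)
  then show ?case
    using p insert.prems order_refl order_trans by (metis insert_iff subsetD)
qed

lemma finite_chain_has_min:
  assumes "finite C" "C \<noteq> {}" "C \<subseteq> P" "C \<in> Chains r"
  shows "\<exists>p\<in>C. \<forall>q\<in>C. (p, q) \<in> r"
proof -
  interpret dual: partial_order_set P "r\<inverse>"
    by unfold_locales (simp add: partial_order)
  show ?thesis
    using dual.finite_chain_has_max[of C] assms by (auto simp: Chains_def)
qed

end

text \<open>Each weight is the gap between an element and its predecessor in
  \<open>insert 0 V\<close>, so partial sums telescope. That the total lies in
  \<open>insert 0 V\<close> serves the induction: it keeps \<open>b - sum W V\<close> nonnegative
  for the new maximum \<open>b\<close>.\<close>

lemma exists_telescoping_weights:
  fixes V :: "real set"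
  assumes "finite V" "V \<subseteq> {0<..}"
  shows "\<exists>W. (\<forall>v\<in>V. 0 \<le> W v) \<and> sum W V \<in> insert 0 V \<and>
    (\<forall>x\<in>insert 0 V. (\<Sum>v\<in>{v\<in>V. v \<le> x}. W v) = x)"
  using assms
proof (induction V rule: finite_linorder_max_induct)
  case empty
  then show ?case by auto
next
  case (insert b V)
  then obtain W where W: "\<forall>v\<in>V. 0 \<le> W v" "sum W V \<in> insert 0 V"
    "\<forall>x\<in>insert 0 V. (\<Sum>v\<in>{v\<in>V. v \<le> x}. W v) = x" by auto
  define W' where "W' = W(b := b - sum W V)"
  have b: "b \<notin> V" using insert.hyps by blast
  have same: "sum W' B = sum W B" if "B \<subseteq> V" for B
    using that b by (intro sum.cong) (auto simp: W'_def)
  have tot: "sum W' (insert b V) = b"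
    using same[of V] insert.hyps b by (simp add: W'_def)
  have "sum W V \<le> b"
    using W(2) insert by (auto intro: less_imp_le)
  then have "\<forall>v\<in>insert b V. 0 \<le> W' v"
    using W(1) b by (auto simp: W'_def)
  moreover have "(\<Sum>v\<in>{v\<in>insert b V. v \<le> x}. W' v) = x" if "x \<in> insert 0 (insert b V)" for x
  proof (cases "x = b")
    case True
    then have "{v\<in>insert b V. v \<le> x} = insert b V" using insert.hyps by force
    then show ?thesis using tot True by simp
  next
    case False
    then have "x \<in> insert 0 V" "x < b" using that insert by auto
    then have "{v\<in>insert b V. v \<le> x} = {v\<in>V. v \<le> x}" by auto
    then show ?thesis using same[of "{v\<in>V. v \<le> x}"] W(3) \<open>x \<in> insert 0 V\<close> by auto
  qed
  ultimately show ?case using tot by (intro exI[of _ W']) auto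
qed

context partial_order_set
begin

section \<open>Points of the realization as weighted chains\<close>

lemma poset_vertex_apply: "s \<in> P \<Longrightarrow> poset_vertex P r p s = (if (s, p) \<in> r then 1 else 0)"
  by (simp add: poset_vertex_def indicator_def)

lemma inj_on_poset_vertex: "inj_on (poset_vertex P r) P"
proof (rule inj_onI)
  fix p q assume pq: "p \<in> P" "q \<in> P" and eq: "poset_vertex P r p = poset_vertex P r q"
  have "(s, p) \<in> r \<longleftrightarrow> (s, q) \<in> r" if "s \<in> P" for s
    using fun_cong[OF eq, of s] that by (auto simp: poset_vertex_apply split: if_splits)
  then show "p = q" using pq order_refl order_antisym by blast
qed

text \<open>Distinct elements give distinct vertices, so weights on vertices become weights on the
  chain \<open>C\<close>. The value at \<open>s\<close> is then the total weight of the chain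
  members above \<open>s\<close>.\<close>

lemma realization_points_eq_weights:
  "g \<in> realization_points P r \<longleftrightarrow>
    (\<exists>C W. C \<subseteq> P \<and> C \<noteq> {} \<and> finite C \<and> C \<in> Chains r \<and> (\<forall>p\<in>C. 0 \<le> W p) \<and> sum W C = 1 \<and>
      g = (\<lambda>s\<in>P. \<Sum>p\<in>{p\<in>C. (s, p) \<in> r}. W p))"
proof -
  have eq: "(\<lambda>s\<in>P. \<Sum>f\<in>poset_vertex P r ` C. w f * f s) =
      (\<lambda>s\<in>P. \<Sum>p\<in>{p\<in>C. (s, p) \<in> r}. W p)"
    if "C \<subseteq> P" "finite C" "\<And>p. p \<in> C \<Longrightarrow> W p = w (poset_vertex P r p)" for C and W :: "'a \<Rightarrow> real" and w
  proof (rule restrict_ext)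
    fix s assume "s \<in> P"
    have "(\<Sum>f\<in>poset_vertex P r ` C. w f * f s) = (\<Sum>p\<in>C. if (s, p) \<in> r then W p else 0)"
      using that \<open>s \<in> P\<close> inj_on_subset[OF inj_on_poset_vertex \<open>C \<subseteq> P\<close>]
      by (subst sum.reindex) (auto simp: poset_vertex_apply intro!: sum.cong)
    then show "(\<Sum>f\<in>poset_vertex P r ` C. w f * f s) = (\<Sum>p\<in>{p\<in>C. (s, p) \<in> r}. W p)"
      using \<open>finite C\<close> by (simp add: sum.inter_filter)
  qed
  have tot: "sum w (poset_vertex P r ` C) = sum W C"
    if "C \<subseteq> P" "\<And>p. p \<in> C \<Longrightarrow> W p = w (poset_vertex P r p)" for C and W :: "'a \<Rightarrow> real" and w
    using that inj_on_subset[OF inj_on_poset_vertex \<open>C \<subseteq> P\<close>]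
    by (subst sum.reindex) (auto intro!: sum.cong)
  show ?thesis
  proof
    assume "g \<in> realization_points P r"
    then obtain C w where C: "C \<subseteq> P" "C \<noteq> {}" "finite C" "C \<in> Chains r"
      and w: "\<forall>f\<in>poset_vertex P r ` C. 0 \<le> w f" "sum w (poset_vertex P r ` C) = 1"
      and g: "g = (\<lambda>s\<in>P. \<Sum>f\<in>poset_vertex P r ` C. w f * f s)"
      unfolding realization_points_def fun_convex_hull_def by blast
    show "\<exists>C W. C \<subseteq> P \<and> C \<noteq> {} \<and> finite C \<and> C \<in> Chains r \<and> (\<forall>p\<in>C. 0 \<le> W p) \<and>
        sum W C = 1 \<and> g = (\<lambda>s\<in>P. \<Sum>p\<in>{p\<in>C. (s, p) \<in> r}. W p)"
      using C w g eq[OF C(1,3), of "\<lambda>p. w (poset_vertex P r p)" w]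
        tot[OF C(1), of "\<lambda>p. w (poset_vertex P r p)" w]
      by (intro exI[of _ C] exI[of _ "\<lambda>p. w (poset_vertex P r p)"]) auto
  next
    assume "\<exists>C W. C \<subseteq> P \<and> C \<noteq> {} \<and> finite C \<and> C \<in> Chains r \<and> (\<forall>p\<in>C. 0 \<le> W p) \<and>
        sum W C = 1 \<and> g = (\<lambda>s\<in>P. \<Sum>p\<in>{p\<in>C. (s, p) \<in> r}. W p)"
    then obtain C and W :: "'a \<Rightarrow> real" where C: "C \<subseteq> P" "C \<noteq> {}" "finite C" "C \<in> Chains r"
      and W: "\<forall>p\<in>C. 0 \<le> W p" "sum W C = 1"
      and g: "g = (\<lambda>s\<in>P. \<Sum>p\<in>{p\<in>C. (s, p) \<in> r}. W p)"
      by blast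
    define w where "w f = W (inv_into P (poset_vertex P r) f)" for f
    have Ww: "W p = w (poset_vertex P r p)" if "p \<in> C" for p
      using that C(1) inv_into_f_f[OF inj_on_poset_vertex] by (auto simp: w_def)
    have "g \<in> fun_convex_hull P (poset_vertex P r ` C)"
      unfolding fun_convex_hull_def
      using eq[of C W w, OF C(1,3) Ww] tot[of C W w, OF C(1) Ww] W g Ww by (auto intro!: exI[of _ w])
    then show "g \<in> realization_points P r"
      unfolding realization_points_def using C by blast
  qed
qed

text \<open>The vertices of the simplex containing \<open>g\<close> are the generators of its principal superlevel
  sets, and the weights are the gaps between consecutive values.\<close>

theorem realization_points_iff:
  "g \<in> realization_points P r \<longleftrightarrow>
    g \<in> P \<rightarrow>\<^sub>E {0..1} \<and> finite (g ` P) \<and> (\<forall>t. 0 < t \<longrightarrow> t \<le> 1 \<longrightarrow> (\<exists>p\<in>P. superlevel P g t = down p))"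
    (is "_ \<longleftrightarrow> ?R")
proof
  assume g: "g \<in> realization_points P r"
  have rng: "g \<in> P \<rightarrow>\<^sub>E {0..1}"
  proof -
    have "realization_points P r \<subseteq> mspace (unit_funspace P)"
      using mspace_geometric_realization[of P r] by (auto simp: geometric_realization_def)
    then show ?thesis using g by (auto simp: mspace_unit_funspace)
  qed
  obtain C and W :: "'a \<Rightarrow> real" where C: "C \<subseteq> P" "C \<noteq> {}" "finite C" "C \<in> Chains r"
      and W: "\<forall>p\<in>C. 0 \<le> W p" "sum W C = 1"
      and gdef: "g = (\<lambda>s\<in>P. \<Sum>p\<in>{p\<in>C. (s, p) \<in> r}. W p)"
    using g unfolding realization_points_eq_weights by blast
  have gs: "g s = (\<Sum>p\<in>{p\<in>C. (s, p) \<in> r}. W p)" if "s \<in> P" for s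
    using that gdef by simp
  have "g ` P \<subseteq> sum W ` Pow C"
    using gs by auto
  then have fin: "finite (g ` P)"
    using C(3) by (meson finite_Pow_iff finite_imageI finite_subset)
  have mono: "g q \<le> g s" if "s \<in> P" "q \<in> P" "(s, q) \<in> r" for s q
    unfolding gs[OF that(1)] gs[OF that(2)] using C(3) W(1) order_trans[OF that(3)]
    by (intro sum_mono2) auto
  have "\<exists>p\<in>P. superlevel P g t = down p" if t: "0 < t" "t \<le> 1" for t
  proof -
    \<comment> \<open>The largest member of \<open>?D\<close> generates the superlevel set.
      \<open>?D\<close> is nonempty because all the weight lies above the least member
      \<open>m\<close>, so \<open>g m\<close> is 1.\<close>
    let ?D = "{p\<in>C. t \<le> g p}"
    obtain m where m: "m \<in> C" "\<forall>q\<in>C. (m, q) \<in> r"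
      using finite_chain_has_min[OF C(3,2,1,4)] by blast
    have "{p\<in>C. (m, p) \<in> r} = C" using m by blast
    then have "m \<in> ?D" using m C gs[of m] W t by auto
    then obtain p where p: "p \<in> ?D" "\<forall>q\<in>?D. (q, p) \<in> r"
      using finite_chain_has_max[of ?D] C by (auto simp: Chains_def)
    have "superlevel P g t = down p"
    proof (intro set_eqI iffI)
      fix s assume "s \<in> superlevel P g t"
      then have s: "s \<in> P" "t \<le> g s" by (auto simp: superlevel_def)
      \<comment> \<open>The chain members above \<open>s\<close> are those above their least element
        \<open>q\<close>, so \<open>g s = g q\<close>; an empty \<open>?E\<close> would give
        \<open>g s = 0\<close>.\<close>
      let ?E = "{q\<in>C. (s, q) \<in> r}"
      have "?E \<noteq> {}" using s t gs by force
      then obtain q where q: "q \<in> ?E" "\<forall>q'\<in>?E. (q, q') \<in> r"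
        using finite_chain_has_min[of ?E] C by (auto simp: Chains_def)
      have "?E = {q'\<in>C. (q, q') \<in> r}" using q order_trans by blast
      moreover have "q \<in> P" using q C(1) by blast
      ultimately have "g s = g q" using gs[OF s(1)] gs[of q] by simp
      then have "(q, p) \<in> r" using p q s by auto
      then show "s \<in> down p" using q s order_trans by (auto simp: down_def)
    next
      fix s assume "s \<in> down p"
      then show "s \<in> superlevel P g t"
        using mono[of s p] p C by (auto simp: down_def superlevel_def)
    qed
    then show ?thesis using p C by blast
  qed
  with rng fin show ?R by blast
next
  assume R: ?R
  then obtain m where m: "\<And>t. 0 < t \<Longrightarrow> t \<le> 1 \<Longrightarrow> m t \<in> P \<and> superlevel P g t = down (m t)"
    by metis
  have lev: "t \<le> g s \<longleftrightarrow> (s, m t) \<in> r" if "0 < t" "t \<le> 1" "s \<in> P" for s t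
    using m[OF that(1,2)] that(3) by (auto simp: superlevel_def down_def)
  have g01: "0 \<le> g s" "g s \<le> 1" if "s \<in> P" for s
    using R that by (auto simp: PiE_iff)
  define V where "V = g ` P \<inter> {0<..}"
  have V: "finite V" "V \<subseteq> {0<..}" "V \<subseteq> {0<..1}"
    using R g01 by (auto simp: V_def)
  \<comment> \<open>The value 1 is attained; this makes the weights sum to 1 below.\<close>
  have "g (m 1) = 1"
    using lev[of 1 "m 1"] m[of 1] order_refl[of "m 1"] g01[of "m 1"] by simp
  then have "1 \<in> V" using m[of 1] by (auto simp: V_def image_iff intro!: bexI[of _ "m 1"])
  obtain W where W: "\<forall>v\<in>V. 0 \<le> W v" "\<forall>x\<in>insert 0 V. (\<Sum>v\<in>{v\<in>V. v \<le> x}. W v) = x"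
    using exists_telescoping_weights[OF V(1,2)] by blast
  have anti: "(m v, m u) \<in> r" if "0 < u" "u \<le> v" "v \<le> 1" for u v
    using lev[of v "m v"] lev[of u "m v"] m[of v] order_refl that by auto
  have inj: "inj_on m V"
  proof (rule inj_onI)
    fix u v assume uv: "u \<in> V" "v \<in> V" "m u = m v"
    have "u \<le> v" if "u \<in> V" "v \<in> V" "m u = m v" for u v
    proof -
      obtain s where s: "s \<in> P" "g s = v" using \<open>v \<in> V\<close> by (auto simp: V_def)
      have "(s, m v) \<in> r" using lev[of v s] s V(3) that by auto
      then show "u \<le> v" using lev[of u s] s V(3) that by auto
    qed
    from this[OF uv] this[of v u] uv show "u = v" by auto
  qed
  define Z where "Z p = W (inv_into V m p)" for p
  have Z: "Z (m v) = W v" if "v \<in> V" for v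
    using inj that by (simp add: Z_def)
  have "g s = (\<Sum>p\<in>{p\<in>m ` V. (s, p) \<in> r}. Z p)" if "s \<in> P" for s
  proof -
    \<comment> \<open>The generators above \<open>s\<close> are those of the levels up to
      \<open>g s\<close>, so their weights telescope to \<open>g s\<close>.\<close>
    have "{p\<in>m ` V. (s, p) \<in> r} = m ` {v\<in>V. v \<le> g s}"
      using lev[OF _ _ that] V(3) by auto
    then have "(\<Sum>p\<in>{p\<in>m ` V. (s, p) \<in> r}. Z p) = (\<Sum>v\<in>{v\<in>V. v \<le> g s}. W v)"
      using Z by (simp add: sum.reindex inj_on_subset[OF inj])
    moreover from W(2) have "(\<Sum>v\<in>{v\<in>V. v \<le> g s}. W v) = g s"
      if "g s \<in> insert 0 V" using that by blast
    moreover have "g s \<in> insert 0 V" using that g01[OF that] by (force simp: V_def)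
    ultimately show ?thesis by metis
  qed
  then have "g = (\<lambda>s\<in>P. \<Sum>p\<in>{p\<in>m ` V. (s, p) \<in> r}. Z p)"
    using R by (auto simp: fun_eq_iff PiE_iff extensional_def)
  moreover have "sum Z (m ` V) = 1"
  proof -
    have "{v\<in>V. v \<le> 1} = V" using V(3) by auto
    then have "sum W V = 1" using W(2) \<open>1 \<in> V\<close> by force
    then show ?thesis using Z by (simp add: sum.reindex[OF inj])
  qed
  moreover have "m ` V \<in> Chains r"
    unfolding Chains_def using anti V(3) by (auto simp: subset_iff) (metis linear)
  moreover have "m ` V \<subseteq> P" using m V(3) by (auto simp: subset_iff)
  moreover have "\<forall>p\<in>m ` V. 0 \<le> Z p" using Z W(1) by auto
  ultimately show "g \<in> realization_points P r"
    unfolding realization_points_eq_weights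
    using V(1) \<open>1 \<in> V\<close> by (intro exI[of _ "m ` V"] exI[of _ Z]) auto
qed

section \<open>Coordinate bounds and the sup metric\<close>

lemma realization_points_bounds:
  assumes "f \<in> realization_points P r" "s \<in> P"
  shows "0 \<le> f s" "f s \<le> 1"
  using assms by (auto simp: realization_points_iff PiE_iff)

lemma superlevel_realization_point:
  assumes "f \<in> realization_points P r" "0 < t" "t \<le> 1"
  obtains p where "p \<in> P" "superlevel P f t = down p"
  using assms by (auto simp: realization_points_iff)

lemma realization_points_nonempty:
  assumes "realization_points P r \<noteq> {}"
  shows "P \<noteq> {}"
proof -
  obtain f where "f \<in> realization_points P r" using assms by blast
  then obtain p where "p \<in> P" by (rule superlevel_realization_point[of f 1]) auto
  then show ?thesis by blast
qed

lemma mdist_realization_le: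
  assumes "f \<in> realization_points P r" "g \<in> realization_points P r"
    and "\<And>s. s \<in> P \<Longrightarrow> \<bar>f s - g s\<bar> \<le> c" and "P \<noteq> {}"
  shows "mdist (geometric_realization P r) f g \<le> c"
proof -
  have "mdist (geometric_realization P r) f g = (SUP s\<in>P. \<bar>f s - g s\<bar>)"
    using assms(1,2,4) by (simp add: geometric_realization_def mdist_unit_funspace realization_points_iff)
  then show ?thesis using assms(3,4) by (auto intro!: cSUP_least)
qed

lemma abs_diff_le_mdist_realization:
  assumes "f \<in> realization_points P r" "g \<in> realization_points P r" "s \<in> P"
  shows "\<bar>f s - g s\<bar> \<le> mdist (geometric_realization P r) f g"
proof -
  have "mdist (geometric_realization P r) f g = (SUP s\<in>P. \<bar>f s - g s\<bar>)"
    using assms by (subst geometric_realization_def)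
      (auto simp: realization_points_iff intro!: mdist_unit_funspace)
  moreover have "bdd_above ((\<lambda>s. \<bar>f s - g s\<bar>) ` P)"
    using realization_points_bounds[OF assms(1)] realization_points_bounds[OF assms(2)]
    by (intro bdd_aboveI2[of _ _ 1]) (smt (verit))
  ultimately show ?thesis using assms(3) by (simp add: cSUP_upper[where f="\<lambda>s. \<bar>f s - g s\<bar>"])
qed

subsection \<open>Separability\<close>

definition rounding :: "nat \<Rightarrow> ('a \<Rightarrow> real) \<Rightarrow> 'a \<Rightarrow> real" where
  "rounding n f = (\<lambda>s\<in>P. of_int \<lfloor>real n * f s\<rfloor> / real n)"

text \<open>The rounded function reaches level \<open>t\<close> exactly where \<open>f\<close>
  reaches \<open>t\<close> rounded up to a multiple of \<open>1 / n\<close>, so its superlevel sets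
  are among those of \<open>f\<close> and remain principal.\<close>

lemma rounding_in_realization_points:
  assumes f: "f \<in> realization_points P r" and n: "0 < n"
  shows "rounding n f \<in> realization_points P r"
  unfolding realization_points_iff
proof (intro conjI allI impI)
  show "rounding n f \<in> P \<rightarrow>\<^sub>E {0..1}"
  proof (rule PiE_I)
    fix s assume s: "s \<in> P"
    have "of_int \<lfloor>real n * f s\<rfloor> \<le> real n"
      using realization_points_bounds[OF f s] of_int_floor_le[of "real n * f s"]
      by (metis mult_left_le of_nat_0_le_iff order.trans)
    then show "rounding n f s \<in> {0..1}"
      using s n realization_points_bounds[OF f s] by (simp add: rounding_def)
  qed (simp add: rounding_def)
  have "rounding n f ` P = (\<lambda>x. of_int \<lfloor>real n * x\<rfloor> / real n) ` f ` P"
    by (auto simp: rounding_def image_iff)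
  then show "finite (rounding n f ` P)"
    using f by (simp add: realization_points_iff)
next
  fix t :: real assume t: "0 < t" "t \<le> 1"
  let ?t = "of_int \<lceil>real n * t\<rceil> / real n"
  have "0 < ?t" using t n by simp
  moreover have "?t \<le> 1"
  proof -
    have "\<lceil>real n * t\<rceil> \<le> int n" using t by (simp add: ceiling_le_iff mult_left_le)
    then have "real_of_int \<lceil>real n * t\<rceil> \<le> real n" by linarith
    then show ?thesis using n by simp
  qed
  moreover have "superlevel P (rounding n f) t = superlevel P f ?t"
  proof -
    have "t \<le> of_int \<lfloor>real n * x\<rfloor> / real n \<longleftrightarrow> ?t \<le> x" for x
    proof -
      have "t \<le> of_int \<lfloor>real n * x\<rfloor> / real n \<longleftrightarrow> real n * t \<le> of_int \<lfloor>real n * x\<rfloor>"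
        using n by (simp add: pos_le_divide_eq mult.commute)
      also have "\<dots> \<longleftrightarrow> of_int \<lceil>real n * t\<rceil> \<le> real n * x"
        by (simp add: ceiling_le_iff[symmetric] le_floor_iff)
      also have "\<dots> \<longleftrightarrow> ?t \<le> x" using n by (simp add: pos_divide_le_eq mult.commute)
      finally show ?thesis .
    qed
    then show ?thesis by (auto simp: superlevel_def rounding_def)
  qed
  ultimately show "\<exists>p\<in>P. superlevel P (rounding n f) t = down p"
    using superlevel_realization_point[OF f] by metis
qed

lemma rounding_approx:
  assumes "0 < n" "s \<in> P"
  shows "\<bar>rounding n f s - f s\<bar> \<le> 1 / real n"
proof -
  have "\<bar>rounding n f s - f s\<bar> = \<bar>(of_int \<lfloor>real n * f s\<rfloor> - real n * f s) / real n\<bar>"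
    using assms by (simp add: rounding_def diff_divide_distrib)
  also have "\<dots> = \<bar>of_int \<lfloor>real n * f s\<rfloor> - real n * f s\<bar> / real n"
    by simp
  also have "\<dots> \<le> 1 / real n"
    by (intro divide_right_mono) linarith+
  finally show ?thesis .
qed

text \<open>A point with values in \<open>(1/n)\<int>\<close> is determined by the generators of its superlevel
  sets at the levels \<open>1/n, \<dots>, n/n\<close>.\<close>

lemma countable_rounding_image:
  assumes "countable P"
  shows "countable (rounding n ` realization_points P r)"
proof (cases "n = 0")
  case True
  \<comment> \<open>Division by 0 yields 0, so at most one function remains.\<close>
  then have "rounding n ` realization_points P r \<subseteq> {\<lambda>s\<in>P. 0}"
    by (auto simp: rounding_def)
  then show ?thesis by (meson countable_finite finite.emptyI finite.insertI finite_subset)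
next
  case False
  \<comment> \<open>Decodes a list of generators: entry \<open>l ! i\<close> belongs to level
    \<open>(i + 1) / n\<close>, so counting the entries above \<open>s\<close> recovers
    \<open>n\<close> times the value.\<close>
  define G :: "'a list \<Rightarrow> 'a \<Rightarrow> real" where
    "G l = (\<lambda>s\<in>P. real (card {i. i < n \<and> (s, l ! i) \<in> r}) / real n)" for l
  have "rounding n ` realization_points P r \<subseteq> G ` lists P"
  proof
    fix g assume "g \<in> rounding n ` realization_points P r"
    then obtain f where f: "f \<in> realization_points P r" and g: "g = rounding n f" by blast
    have "\<exists>p\<in>P. superlevel P f (real (Suc i) / real n) = down p" if "i < n" for i
    proof -
      have "0 < real (Suc i) / real n" "real (Suc i) / real n \<le> 1" using that by auto
      then show ?thesis using superlevel_realization_point[OF f] by metis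
    qed
    then obtain m where m: "\<And>i. i < n \<Longrightarrow> m i \<in> P \<and> superlevel P f (real (Suc i) / real n) = down (m i)"
      by metis
    have "g = G (map m [0..<n])"
    proof
      fix s
      show "g s = G (map m [0..<n]) s"
      proof (cases "s \<in> P")
        case s: True
        note b = realization_points_bounds[OF f s]
        have "{i. i < n \<and> (s, m i) \<in> r} = {..<nat \<lfloor>real n * f s\<rfloor>}"
        proof (intro set_eqI iffI)
          fix i assume "i \<in> {i. i < n \<and> (s, m i) \<in> r}"
          then have "i < n" "real (Suc i) / real n \<le> f s"
            using m s by (auto simp: superlevel_def down_def set_eq_iff)
          then have "real (Suc i) \<le> real n * f s" by (simp add: pos_divide_le_eq mult.commute)
          then show "i \<in> {..<nat \<lfloor>real n * f s\<rfloor>}"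
            by (simp add: le_nat_floor flip: Suc_le_eq)
        next
          fix i assume "i \<in> {..<nat \<lfloor>real n * f s\<rfloor>}"
          then have "int (Suc i) \<le> \<lfloor>real n * f s\<rfloor>" by auto
          then have le: "real (Suc i) \<le> real n * f s" by linarith
          have "real n * f s \<le> real n" using b by (simp add: mult_left_le)
          then have "i < n" using le by linarith
          moreover have "real (Suc i) / real n \<le> f s"
            using le \<open>i < n\<close> by (simp add: pos_divide_le_eq mult.commute)
          ultimately show "i \<in> {i. i < n \<and> (s, m i) \<in> r}"
            using m s by (auto simp: superlevel_def down_def set_eq_iff)
        qed
        moreover have "{i. i < n \<and> (s, map m [0..<n] ! i) \<in> r} = {i. i < n \<and> (s, m i) \<in> r}"
          by auto
        ultimately show ?thesis using s b by (simp add: g G_def rounding_def)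
      qed (simp add: g G_def rounding_def)
    qed
    moreover have "map m [0..<n] \<in> lists P" using m by auto
    ultimately show "g \<in> G ` lists P" by blast
  qed
  then show ?thesis
    using countable_lists[OF assms] by (meson countable_image countable_subset)
qed

text \<open>Roundings approximate within \<open>1 / n\<close>, so those for all positive
  \<open>n\<close> form a countable dense set. It is enumerated as a sequence because the penalties
  will refer to earlier indices.\<close>

lemma realization_separable:
  assumes "countable P" "realization_points P r \<noteq> {}"
  shows "\<exists>b :: nat \<Rightarrow> 'a \<Rightarrow> real. range b \<subseteq> realization_points P r \<and>
    (\<forall>f\<in>realization_points P r. \<forall>c>0. \<exists>i. mdist (geometric_realization P r) (b i) f < c)"
proof -
  have "P \<noteq> {}" using assms(2) by (rule realization_points_nonempty)
  define B where "B = (\<Union>n\<in>{0<..}. rounding n ` realization_points P r)"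
  have B: "countable B" "B \<noteq> {}" "B \<subseteq> realization_points P r"
    using countable_rounding_image[OF assms(1)] assms(2) rounding_in_realization_points
    by (auto simp: B_def)
  obtain b :: "nat \<Rightarrow> 'a \<Rightarrow> real" where b: "range b = B"
    using uncountable_def B by metis
  show ?thesis
  proof (intro exI[of _ b] conjI ballI allI impI)
    show "range b \<subseteq> realization_points P r" using b B by simp
    fix f and c :: real assume f: "f \<in> realization_points P r" and c: "0 < c"
    obtain n :: nat where n: "0 < n" "1 / real n < c"
      using c by (metis ex_inverse_of_nat_less inverse_eq_divide)
    have "rounding n f \<in> B" using f n by (auto simp: B_def)
    then obtain i where i: "b i = rounding n f" using b by (metis imageE)
    have "mdist (geometric_realization P r) (b i) f \<le> 1 / real n"
      unfolding i using rounding_in_realization_points[OF f n(1)] f rounding_approx[OF n(1)] \<open>P \<noteq> {}\<close>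
      by (intro mdist_realization_le) auto
    then show "\<exists>i. mdist (geometric_realization P r) (b i) f < c" using n i by (intro exI[of _ i]) linarith
  qed
qed

end

subsection \<open>Functions with bounded superlevel sets\<close>

locale conditionally_complete_poset = partial_order_set +
  assumes conditionally_complete: "conditionally_complete_on P r"
begin

text \<open>A meaningful value is guaranteed only for nonempty subsets of \<open>P\<close> bounded
  above in \<open>P\<close>.\<close>

definition lub :: "'a set \<Rightarrow> 'a" where
  "lub S = (SOME l. l \<in> P \<and> (\<forall>s\<in>S. (s, l) \<in> r) \<and> (\<forall>u\<in>P. (\<forall>s\<in>S. (s, u) \<in> r) \<longrightarrow> (l, u) \<in> r))"

lemma lub:
  assumes "S \<subseteq> P" "S \<noteq> {}" "u \<in> P" "\<And>s. s \<in> S \<Longrightarrow> (s, u) \<in> r"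
  shows lub_in: "lub S \<in> P" and lub_upper: "s \<in> S \<Longrightarrow> (s, lub S) \<in> r"
    and lub_least: "u' \<in> P \<Longrightarrow> (\<And>s. s \<in> S \<Longrightarrow> (s, u') \<in> r) \<Longrightarrow> (lub S, u') \<in> r"
proof -
  have "S \<subseteq> P \<and> S \<noteq> {} \<and> (\<exists>u\<in>P. \<forall>s\<in>S. (s, u) \<in> r)"
    using assms by (intro conjI bexI[of _ u]) auto
  then have "\<exists>l\<in>P. (\<forall>s\<in>S. (s, l) \<in> r) \<and> (\<forall>u\<in>P. (\<forall>s\<in>S. (s, u) \<in> r) \<longrightarrow> (l, u) \<in> r)"
    using conditionally_complete unfolding conditionally_complete_on_def by (elim allE[of _ S]) simp
  then have l: "lub S \<in> P \<and> (\<forall>s\<in>S. (s, lub S) \<in> r) \<and>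
      (\<forall>u\<in>P. (\<forall>s\<in>S. (s, u) \<in> r) \<longrightarrow> (lub S, u) \<in> r)"
    unfolding lub_def Bex_def by (rule someI_ex)
  from l show "lub S \<in> P" by simp
  from l show "(s, lub S) \<in> r" if "s \<in> S" using that by simp
  from l show "(lub S, u') \<in> r" if "u' \<in> P" "\<And>s. s \<in> S \<Longrightarrow> (s, u') \<in> r" using that by simp
qed

lemma lub_down:
  assumes "p \<in> P"
  shows "lub (down p) = p"
proof -
  have d: "down p \<subseteq> P" "down p \<noteq> {}" "\<And>s. s \<in> down p \<Longrightarrow> (s, p) \<in> r" "p \<in> down p"
    using assms order_refl by (auto simp: down_def)
  show ?thesis
    using lub_upper[OF d(1,2) assms d(3) d(4)] lub_least[OF d(1,2) assms d(3) assms d(3)]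
    by (rule order_antisym[rotated])
qed

text \<open>Weakens the criterion \<open>realization_points_iff\<close>: superlevel sets need only
  be nonempty and bounded above, so that their suprema exist.\<close>

definition tame :: "('a \<Rightarrow> real) \<Rightarrow> bool" where
  "tame u \<longleftrightarrow> u ` P \<subseteq> {0..1} \<and> finite (u ` P) \<and> (\<forall>t. 0 < t \<longrightarrow> t \<le> 1 \<longrightarrow> superlevel P u t \<noteq> {} \<and>
     (\<exists>p\<in>P. superlevel P u t \<subseteq> down p))"

text \<open>Replaces every superlevel set by the principal ideal of its supremum.\<close>

definition realize :: "('a \<Rightarrow> real) \<Rightarrow> 'a \<Rightarrow> real" where
  "realize u = (\<lambda>s\<in>P. Max (insert 0 {v\<in>u ` P. 0 < v \<and> (s, lub (superlevel P u v)) \<in> r}))"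

lemma tame_lub:
  assumes "tame u" "0 < t" "t \<le> 1"
  shows "lub (superlevel P u t) \<in> P" "superlevel P u t \<subseteq> down (lub (superlevel P u t))"
    and "p \<in> P \<Longrightarrow> superlevel P u t \<subseteq> down p \<Longrightarrow> (lub (superlevel P u t), p) \<in> r"
proof -
  have sub: "superlevel P u t \<subseteq> P" by (auto simp: superlevel_def)
  obtain q where q: "q \<in> P" "superlevel P u t \<subseteq> down q" and ne: "superlevel P u t \<noteq> {}"
    using assms unfolding tame_def by blast
  then have q': "\<And>s. s \<in> superlevel P u t \<Longrightarrow> (s, q) \<in> r" by (auto simp: down_def)
  note l = lub[OF sub ne q(1) q']
  show "lub (superlevel P u t) \<in> P" "superlevel P u t \<subseteq> down (lub (superlevel P u t))"
    using l(1,2) sub by (auto simp: down_def)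
  show "(lub (superlevel P u t), p) \<in> r" if "p \<in> P" "superlevel P u t \<subseteq> down p"
    using that by (intro l(3)) (auto simp: down_def)
qed

text \<open>With finite image, \<open>t\<close> can be raised to the next attained value without
  changing the superlevel set. This leads from arbitrary levels to the attained ones over which
  \<open>realize\<close> ranges.\<close>

lemma tame_value_above:
  assumes "tame u" "0 < t" "t \<le> 1"
  obtains v where "v \<in> u ` P" "t \<le> v" "superlevel P u v = superlevel P u t"
proof -
  let ?V = "{v\<in>u ` P. t \<le> v}"
  have "finite ?V" "?V \<noteq> {}"
    using assms unfolding tame_def superlevel_def by auto
  then have v: "Min ?V \<in> ?V" "\<And>w. w \<in> ?V \<Longrightarrow> Min ?V \<le> w"
    using Min_in Min_le by blast+
  show ?thesis
  proof (rule that)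
    show "superlevel P u (Min ?V) = superlevel P u t"
      using v by (force simp: superlevel_def)
  qed (use v(1) in blast)+
qed

text \<open>Suprema descend as the level rises and every level can be replaced by an attained one.
  Thus the superlevel sets of \<open>realize u\<close> are the intended principal ideals.\<close>

lemma le_realize_iff:
  assumes u: "tame u" and t: "0 < t" "t \<le> 1" and s: "s \<in> P"
  shows "t \<le> realize u s \<longleftrightarrow> (s, lub (superlevel P u t)) \<in> r"
proof -
  let ?V = "{v\<in>u ` P. 0 < v \<and> (s, lub (superlevel P u v)) \<in> r}"
  have fin: "finite ?V" using u by (simp add: tame_def)
  have "t \<le> realize u s \<longleftrightarrow> (\<exists>v\<in>?V. t \<le> v)"
    using fin s t by (simp add: realize_def Max_ge_iff)
  also have "\<dots> \<longleftrightarrow> (s, lub (superlevel P u t)) \<in> r"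
  proof
    assume "\<exists>v\<in>?V. t \<le> v"
    then obtain v where v: "v \<in> u ` P" "t \<le> v" "(s, lub (superlevel P u v)) \<in> r" by blast
    then have v1: "0 < v" "v \<le> 1" using u t by (auto simp: tame_def)
    have "superlevel P u v \<subseteq> superlevel P u t" using v by (auto simp: superlevel_def)
    then have "(lub (superlevel P u v), lub (superlevel P u t)) \<in> r"
      using tame_lub[OF u v1] tame_lub[OF u t] by blast
    then show "(s, lub (superlevel P u t)) \<in> r" using v order_trans by blast
  next
    assume "(s, lub (superlevel P u t)) \<in> r"
    moreover obtain v where "v \<in> u ` P" "t \<le> v" "superlevel P u v = superlevel P u t"
      using tame_value_above[OF u t] by blast
    ultimately show "\<exists>v\<in>?V. t \<le> v" using t by (intro bexI[of _ v]) auto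
  qed
  finally show ?thesis .
qed

lemma realize_in_unit_interval:
  assumes "tame u" "s \<in> P"
  shows "0 \<le> realize u s" "realize u s \<le> 1"
proof -
  let ?V = "{v\<in>u ` P. 0 < v \<and> (s, lub (superlevel P u v)) \<in> r}"
  have "finite ?V" "?V \<subseteq> {0..1}" using assms by (auto simp: tame_def)
  then show "0 \<le> realize u s" "realize u s \<le> 1"
    using assms(2) by (auto simp: realize_def subset_iff)
qed

lemma realize_in_realization_points:
  assumes u: "tame u"
  shows "realize u \<in> realization_points P r"
  unfolding realization_points_iff
proof (intro conjI allI impI)
  show "realize u \<in> P \<rightarrow>\<^sub>E {0..1}"
    using realize_in_unit_interval[OF u] by (auto simp: PiE_iff realize_def)
  have "realize u s \<in> insert 0 (u ` P)" if "s \<in> P" for s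
  proof -
    let ?V = "{v\<in>u ` P. 0 < v \<and> (s, lub (superlevel P u v)) \<in> r}"
    have "Max (insert 0 ?V) \<in> insert 0 ?V" using u by (intro Max_in) (auto simp: tame_def)
    then show ?thesis using that by (auto simp: realize_def)
  qed
  then have "realize u ` P \<subseteq> insert 0 (u ` P)" by blast
  moreover have "finite (insert 0 (u ` P))" using u by (simp add: tame_def)
  ultimately show "finite (realize u ` P)" by (rule finite_subset)
next
  fix t :: real assume t: "0 < t" "t \<le> 1"
  show "\<exists>p\<in>P. superlevel P (realize u) t = down p"
    using tame_lub(1)[OF u t] le_realize_iff[OF u t]
    by (intro bexI[of _ "lub (superlevel P u t)"]) (auto simp: superlevel_def down_def)
qed

text \<open>The superlevel set of \<open>u\<close> at \<open>t\<close> lies in that of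
  \<open>v\<close> at \<open>t - c\<close>, and suprema preserve this; take
  \<open>t = realize u s\<close>. Applied both ways, this is nonexpansiveness.\<close>

lemma realize_le_add:
  assumes u: "tame u" and v: "tame v" and c: "0 \<le> c" and s: "s \<in> P"
    and le: "\<And>q. q \<in> P \<Longrightarrow> u q \<le> v q + c"
  shows "realize u s \<le> realize v s + c"
proof (cases "realize u s \<le> c")
  case True
  then show ?thesis using realize_in_unit_interval[OF v s] by simp
next
  case False
  define t where "t = realize u s"
  have t: "0 < t" "t \<le> 1" "0 < t - c" "t - c \<le> 1"
    using False c realize_in_unit_interval[OF u s] by (auto simp: t_def)
  have "superlevel P u t \<subseteq> superlevel P v (t - c)"
    using le by (force simp: superlevel_def)
  then have "(lub (superlevel P u t), lub (superlevel P v (t - c))) \<in> r"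
    using tame_lub[OF u t(1,2)] tame_lub[OF v t(3,4)] by blast
  moreover have "(s, lub (superlevel P u t)) \<in> r"
    using le_realize_iff[OF u t(1,2) s] by (simp add: t_def)
  ultimately have "t - c \<le> realize v s"
    using le_realize_iff[OF v t(3,4) s] order_trans by blast
  then show ?thesis by (simp add: t_def)
qed

text \<open>The supremum of a principal ideal is its generator, so \<open>realize\<close> leaves all
  superlevel sets at levels in (0,1] unchanged.\<close>

lemma realize_realization_point:
  assumes f: "f \<in> realization_points P r"
  shows "tame f" "realize f = f"
proof -
  have lev: "\<exists>p\<in>P. superlevel P f t = down p" if "0 < t" "t \<le> 1" for t
    using superlevel_realization_point[OF f that] by metis
  show tame: "tame f"
    unfolding tame_def
  proof (intro conjI allI impI)
    fix t :: real assume t: "0 < t" "t \<le> 1"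
    then obtain p where "p \<in> P" "superlevel P f t = down p" using lev by blast
    then show "superlevel P f t \<noteq> {}" "\<exists>p\<in>P. superlevel P f t \<subseteq> down p"
      using order_refl by (auto simp: down_def)
  qed (use f in \<open>auto simp: realization_points_iff PiE_iff\<close>)
  show "realize f = f"
  proof
    fix s show "realize f s = f s"
    proof (cases "s \<in> P")
      case s: True
      have iff: "t \<le> realize f s \<longleftrightarrow> t \<le> f s" if t: "0 < t" "t \<le> 1" for t
      proof -
        obtain p where "p \<in> P" "superlevel P f t = down p" using lev t by blast
        then show ?thesis
          using le_realize_iff[OF tame t s] lub_down s by (auto simp: superlevel_def down_def set_eq_iff)
      qed
      have "0 \<le> realize f s" "realize f s \<le> 1" "0 \<le> f s" "f s \<le> 1"
        using realize_in_unit_interval[OF tame s] realization_points_bounds[OF f s] by auto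
      then show ?thesis using iff[of "f s"] iff[of "realize f s"] by linarith
    next
      case False
      then show ?thesis using f by (auto simp: realize_def realization_points_iff PiE_iff extensional_def)
    qed
  qed
qed

end

subsection \<open>Concave moduli of continuity\<close>

text \<open>An infimum of affine functions of \<open>t\<close>, hence concave. If a [0,1]-valued map
  varies by less than \<open>1 / (n + 1)\<close> at distances below \<open>\<delta> n\<close>, each
  affine function bounds its variation: by the constant term at such distances, by
  \<open>t / \<delta> n \<ge> 1\<close> beyond them.\<close>

definition concave_modulus :: "(nat \<Rightarrow> real) \<Rightarrow> real \<Rightarrow> real" where
  "concave_modulus \<delta> t = (INF n. 1 / real (Suc n) + t / \<delta> n)"

context
  fixes \<delta> :: "nat \<Rightarrow> real"
  assumes \<delta>: "\<And>n. 0 < \<delta> n" "\<And>n. \<delta> n \<le> 1"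
begin

lemma concave_modulus_bdd:
  assumes "0 \<le> t"
  shows "bdd_below (range (\<lambda>n. 1 / real (Suc n) + t / \<delta> n))"
  using assms \<delta>(1) by (intro bdd_belowI2[of _ 0]) (simp add: less_imp_le)

lemma concave_modulus_le: "0 \<le> t \<Longrightarrow> concave_modulus \<delta> t \<le> 1 / real (Suc n) + t / \<delta> n"
  unfolding concave_modulus_def by (rule cINF_lower[OF concave_modulus_bdd]) auto

lemma concave_modulus_greatest:
  "(\<And>n. c \<le> 1 / real (Suc n) + t / \<delta> n) \<Longrightarrow> c \<le> concave_modulus \<delta> t"
  unfolding concave_modulus_def by (rule cINF_greatest) auto

text \<open>All slopes \<open>1 / \<delta> n\<close> are at least 1. The new distance therefore
  dominates the metric, and points off a closed set stay at positive distance from it.\<close>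

lemma concave_modulus_ge:
  assumes "0 \<le> t"
  shows "t \<le> concave_modulus \<delta> t"
proof (rule concave_modulus_greatest)
  fix n
  have "t * \<delta> n \<le> t" using assms \<delta>[of n] by (simp add: mult_left_le)
  then have "t \<le> t / \<delta> n" using \<delta>(1)[of n] by (simp add: pos_le_divide_eq)
  then show "t \<le> 1 / real (Suc n) + t / \<delta> n" by (simp add: add_increasing)
qed

lemma concave_modulus_mono:
  assumes "0 \<le> s" "s \<le> t"
  shows "concave_modulus \<delta> s \<le> concave_modulus \<delta> t"
proof (rule concave_modulus_greatest)
  fix n
  have "s / \<delta> n \<le> t / \<delta> n" using assms \<delta>(1)[of n] by (simp add: divide_right_mono less_imp_le)
  then show "concave_modulus \<delta> s \<le> 1 / real (Suc n) + t / \<delta> n"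
    using concave_modulus_le[OF assms(1), of n] by linarith
qed

text \<open>Make the constant term small by \<open>n\<close>, then the linear term by
  \<open>t\<close>. With \<open>concave_modulus_ge\<close> it follows that the new distance induces
  the same uniformity.\<close>

lemma concave_modulus_tendsto_0:
  assumes "0 < c"
  obtains \<tau> where "0 < \<tau>" "\<And>t. 0 \<le> t \<Longrightarrow> t < \<tau> \<Longrightarrow> concave_modulus \<delta> t < c"
proof -
  obtain n where n: "1 / real (Suc n) < c / 2"
    using assms by (metis half_gt_zero nat_approx_posE)
  show ?thesis
  proof
    show "0 < c / 2 * \<delta> n" using assms \<delta>(1) by simp
    fix t assume t: "0 \<le> t" "t < c / 2 * \<delta> n"
    then have "t / \<delta> n < c / 2" using \<delta>(1)[of n] by (simp add: pos_divide_less_eq)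
    then show "concave_modulus \<delta> t < c"
      using concave_modulus_le[OF t(1), of n] n by linarith
  qed
qed

lemma concave_modulus_0: "concave_modulus \<delta> 0 = 0"
proof (rule antisym)
  show "concave_modulus \<delta> 0 \<le> 0"
    using concave_modulus_tendsto_0 by (metis dual_order.refl not_le)
qed (rule concave_modulus_ge, simp)

text \<open>Of the affine functions chosen for \<open>s\<close> and for \<open>t\<close>, the one of
  smaller slope suffices at \<open>s + t\<close>. This gives the triangle inequality for the new
  distance.\<close>

lemma concave_modulus_subadditive:
  assumes st: "0 \<le> s" "0 \<le> t"
  shows "concave_modulus \<delta> (s + t) \<le> concave_modulus \<delta> s + concave_modulus \<delta> t"
proof -
  have *: "concave_modulus \<delta> (s + t) \<le> (1 / real (Suc n) + s / \<delta> n) + (1 / real (Suc m) + t / \<delta> m)" for n m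
  proof (cases "\<delta> m \<le> \<delta> n")
    case True
    have "s / \<delta> n + t / \<delta> n \<le> s / \<delta> n + t / \<delta> m"
      using True st \<delta>(1)[of m] by (simp add: frac_le)
    moreover have "0 \<le> 1 / real (Suc m)" by simp
    ultimately show ?thesis
      using concave_modulus_le[of "s + t" n] st add_divide_distrib[of s t "\<delta> n"] by linarith
  next
    case False
    have "s / \<delta> m + t / \<delta> m \<le> s / \<delta> n + t / \<delta> m"
      using False st \<delta>(1)[of n] by (simp add: frac_le)
    moreover have "0 \<le> 1 / real (Suc n)" by simp
    ultimately show ?thesis
      using concave_modulus_le[of "s + t" m] st add_divide_distrib[of s t "\<delta> m"] by linarith
  qed
  have "concave_modulus \<delta> (s + t) - concave_modulus \<delta> s \<le> concave_modulus \<delta> t"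
  proof (rule concave_modulus_greatest)
    fix m
    have "concave_modulus \<delta> (s + t) - (1 / real (Suc m) + t / \<delta> m) \<le> concave_modulus \<delta> s"
    proof (rule concave_modulus_greatest)
      fix n
      show "concave_modulus \<delta> (s + t) - (1 / real (Suc m) + t / \<delta> m) \<le> 1 / real (Suc n) + s / \<delta> n"
        using *[of n m] by linarith
    qed
    then show "concave_modulus \<delta> (s + t) - concave_modulus \<delta> s \<le> 1 / real (Suc m) + t / \<delta> m"
      by linarith
  qed
  then show ?thesis by linarith
qed

end

subsection \<open>Extension to a neighborhood\<close>

lemma clamp_le_add:
  fixes a b c :: real
  shows "a \<le> b + c \<Longrightarrow> 0 \<le> c \<Longrightarrow> min 1 (max 0 a) \<le> min 1 (max 0 b) + c"
  by linarith

text \<open>\<open>d\<close> models the remetrized ambient space and \<open>f\<close> the inverse of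
  the embedding on its image \<open>A\<close>. The condition \<open>a_dense\<close> combines density
  of the sequence \<open>a\<close> in \<open>A\<close> with closedness of \<open>A\<close>.\<close>

locale realization_extension = conditionally_complete_poset P r
  for P :: "'a set" and r :: "'a rel" +
  fixes M :: "'x set" and d :: "'x \<Rightarrow> 'x \<Rightarrow> real" and A :: "'x set"
    and a :: "nat \<Rightarrow> 'x" and f :: "'x \<Rightarrow> 'a \<Rightarrow> real"
  assumes d_nonneg: "x \<in> M \<Longrightarrow> y \<in> M \<Longrightarrow> 0 \<le> d x y"
    and d_zero: "x \<in> M \<Longrightarrow> d x x = 0"
    and d_commute: "x \<in> M \<Longrightarrow> y \<in> M \<Longrightarrow> d x y = d y x"
    and d_triangle: "x \<in> M \<Longrightarrow> y \<in> M \<Longrightarrow> z \<in> M \<Longrightarrow> d x z \<le> d x y + d y z"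
    and A_subset: "A \<subseteq> M"
    and a_in: "a i \<in> A"
    and a_dense: "x \<in> M \<Longrightarrow> (INF i. d x (a i)) = 0 \<longleftrightarrow> x \<in> A"
    and f_in: "x \<in> A \<Longrightarrow> f x \<in> realization_points P r"
    and f_lipschitz: "x \<in> A \<Longrightarrow> y \<in> A \<Longrightarrow> s \<in> P \<Longrightarrow> f x s \<le> f y s + d x y"
begin

definition D :: "'x \<Rightarrow> real" where
  "D x = (INF i. d x (a i))"

text \<open>Nonpositive exactly when \<open>a i\<close> is within \<open>3 * D x\<close> of
  \<open>x\<close> and no earlier \<open>a j\<close> is closer than that.\<close>

definition excess :: "nat \<Rightarrow> 'x \<Rightarrow> real" where
  "excess i x = Max (insert (d x (a i) - 3 * D x) ((\<lambda>j. 3 * D x - d x (a j)) ` {..<i}))"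

definition penalty :: "nat \<Rightarrow> 'x \<Rightarrow> real" where
  "penalty i x = max 0 (excess i x) / D x"

definition envelope :: "'x \<Rightarrow> 'a \<Rightarrow> real" where
  "envelope x s = (if x \<in> A then f x s else (SUP i. max 0 (f (a i) s - penalty i x)))"

text \<open>The envelope is within \<open>6 * D x\<close> of a point of the realization. The stretching about \<open>1/2\<close>
  sends values below \<open>6 * D x\<close> to 0 and above \<open>1 - 6 * D x\<close> to 1, which makes the superlevel sets
  at all levels in \<open>(0,1]\<close> bounded and nonempty.\<close>

definition stretched :: "'x \<Rightarrow> 'a \<Rightarrow> real" where
  "stretched x = (\<lambda>s\<in>P. min 1 (max 0 (envelope x s + 12 * D x * (2 * envelope x s - 1))))"

definition extension :: "'x \<Rightarrow> 'a \<Rightarrow> real" where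
  "extension x = realize (stretched x)"

lemma a_in_M: "a i \<in> M"
  using a_in A_subset by blast

section \<open>Distance to \<open>A\<close>\<close>

lemma D_bdd: "x \<in> M \<Longrightarrow> bdd_below (range (\<lambda>i. d x (a i)))"
  using d_nonneg a_in_M by (intro bdd_belowI2[of _ 0]) auto

lemma D_le: "x \<in> M \<Longrightarrow> D x \<le> d x (a i)"
  unfolding D_def by (rule cINF_lower[OF D_bdd]) auto

lemma D_nonneg: "x \<in> M \<Longrightarrow> 0 \<le> D x"
  unfolding D_def by (rule cINF_greatest) (auto simp: d_nonneg a_in_M)

lemma D_near: "x \<in> M \<Longrightarrow> D x < c \<Longrightarrow> \<exists>i. d x (a i) < c"
  unfolding D_def by (subst (asm) cINF_less_iff[OF _ D_bdd]) auto

lemma D_zero_iff: "x \<in> M \<Longrightarrow> D x = 0 \<longleftrightarrow> x \<in> A"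
  unfolding D_def by (rule a_dense)

lemma D_pos: "x \<in> M \<Longrightarrow> x \<notin> A \<Longrightarrow> 0 < D x"
  using D_nonneg D_zero_iff by (metis less_eq_real_def)

lemma D_lipschitz:
  assumes "x \<in> M" "y \<in> M"
  shows "D x \<le> D y + d x y"
proof -
  have "D x - d x y \<le> D y"
    unfolding D_def[of y]
  proof (rule cINF_greatest)
    fix i
    show "D x - d x y \<le> d y (a i)"
      using D_le[OF assms(1), of i] d_triangle[OF assms a_in_M[of i]] by linarith
  qed simp
  then show ?thesis by linarith
qed

section \<open>Locality and slope of the penalties\<close>

lemma excess_le_iff: "excess i x \<le> c \<longleftrightarrow> d x (a i) - 3 * D x \<le> c \<and> (\<forall>j<i. 3 * D x - d x (a j) \<le> c)"
  unfolding excess_def by (subst Max_le_iff) auto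

lemma excess_lipschitz:
  assumes "x \<in> M" "y \<in> M"
  shows "excess i x \<le> excess i y + 4 * d x y"
proof -
  have y: "d y (a i) - 3 * D y \<le> excess i y" "\<And>j. j < i \<Longrightarrow> 3 * D y - d y (a j) \<le> excess i y"
    using excess_le_iff[of i y "excess i y"] by auto
  have t: "d x (a j) \<le> d x y + d y (a j)" "d y (a j) \<le> d x y + d x (a j)" for j
    using d_triangle[of x y "a j"] d_triangle[of y x "a j"] d_commute[of x y] assms a_in_M by auto
  have D: "D x \<le> D y + d x y" "D y \<le> D x + d x y"
    using D_lipschitz assms d_commute[of x y] by fastforce+
  have "3 * D x - d x (a j) \<le> excess i y + 4 * d x y" if "j < i" for j
    using y(2)[OF that] t(2)[of j] D(1) by linarith
  moreover have "d x (a i) - 3 * D x \<le> excess i y + 4 * d x y"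
    using y(1) t(1)[of i] D(2) by linarith
  ultimately show ?thesis by (simp add: excess_le_iff)
qed

lemma penalty_nonneg: "x \<in> M \<Longrightarrow> 0 \<le> penalty i x"
  by (simp add: penalty_def D_nonneg)

text \<open>Both thresholds \<open>3 * D x\<close> are relaxed by less than \<open>D x\<close>. The
  second bound excludes every index after a point within \<open>2 * D x\<close>, which leaves
  finitely many.\<close>

lemma penalty_less_1:
  assumes "x \<in> M" "x \<notin> A" "penalty i x < 1"
  shows "d x (a i) < 4 * D x" "\<And>j. j < i \<Longrightarrow> 2 * D x < d x (a j)"
proof -
  have "max 0 (excess i x) < D x"
    using assms D_pos[of x] by (simp add: penalty_def)
  then have "excess i x < D x" by simp
  moreover have "d x (a i) - 3 * D x \<le> excess i x" "\<And>j. j < i \<Longrightarrow> 3 * D x - d x (a j) \<le> excess i x"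
    using excess_le_iff[of i x "excess i x"] by auto
  ultimately show "d x (a i) < 4 * D x" "\<And>j. j < i \<Longrightarrow> 2 * D x < d x (a j)" by fastforce+
qed

text \<open>Take the first \<open>a i\<close> closer than \<open>3 * D x\<close>.\<close>

lemma penalty_eq_0:
  assumes "x \<in> M" "x \<notin> A"
  obtains i where "penalty i x = 0" "d x (a i) < 3 * D x"
proof -
  have ex: "\<exists>i. d x (a i) < 3 * D x"
    using D_pos[OF assms] by (intro D_near assms) simp
  define i where "i = (LEAST i. d x (a i) < 3 * D x)"
  have i: "d x (a i) < 3 * D x" "\<And>j. j < i \<Longrightarrow> \<not> d x (a j) < 3 * D x"
    unfolding i_def using LeastI_ex[OF ex] not_less_Least by blast+
  then have "excess i x \<le> 0" by (simp add: excess_le_iff not_less)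
  then show ?thesis using that[of i] i(1) by (simp add: penalty_def)
qed

text \<open>Of the constant 5, 4 is the slope of \<open>excess\<close> and 1 comes from replacing
  the denominator \<open>D x\<close> by \<open>D y\<close>, which costs
  \<open>penalty i x * d x y \<le> d x y\<close>.\<close>

lemma penalty_le_add:
  assumes x: "x \<in> M" "x \<notin> A" and y: "y \<in> M" "y \<notin> A" and p: "penalty i x \<le> 1"
  shows "penalty i y \<le> penalty i x + 5 * d x y / D y"
proof -
  note pos = D_pos[OF x] D_pos[OF y]
  have "max 0 (excess i y) \<le> max 0 (excess i x) + 4 * d x y"
    using excess_lipschitz[OF y(1) x(1), of i] d_commute[OF x(1) y(1)] d_nonneg[OF x(1) y(1)] by linarith
  also have "max 0 (excess i x) = penalty i x * D x" using pos by (simp add: penalty_def)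
  also have "\<dots> \<le> penalty i x * (D y + d x y)"
    using D_lipschitz[OF x(1) y(1)] penalty_nonneg[OF x(1)] by (intro mult_left_mono)
  also have "\<dots> \<le> penalty i x * D y + d x y"
    using p d_nonneg[OF x(1) y(1)] by (simp add: distrib_left mult_left_le_one_le penalty_nonneg[OF x(1)])
  finally have "max 0 (excess i y) \<le> penalty i x * D y + 5 * d x y" by simp
  then have "penalty i y \<le> (penalty i x * D y + 5 * d x y) / D y"
    unfolding penalty_def[of i y] using pos by (intro divide_right_mono) auto
  then show ?thesis using pos by (simp add: add_divide_distrib)
qed

section \<open>Values, approximation and continuity of the envelope\<close>

lemma envelope_bdd:
  assumes "x \<in> M" "s \<in> P"
  shows "bdd_above (range (\<lambda>i. max 0 (f (a i) s - penalty i x)))"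
proof (rule bdd_aboveI2[of _ _ 1])
  fix i
  show "max 0 (f (a i) s - penalty i x) \<le> 1"
    using realization_points_bounds[OF f_in[OF a_in[of i]] assms(2)] penalty_nonneg[OF assms(1), of i] by simp
qed

lemma envelope_upper:
  assumes "x \<in> M" "x \<notin> A" "s \<in> P"
  shows "max 0 (f (a i) s - penalty i x) \<le> envelope x s"
  unfolding envelope_def using assms by (simp del: max.bounded_iff add: cSUP_upper[OF _ envelope_bdd])

text \<open>Since \<open>f\<close> is at most 1, terms with penalty at least 1 are nonpositive and
  absorbed by \<open>0 \<le> c\<close>.\<close>

lemma envelope_least:
  assumes x: "x \<in> M" "x \<notin> A" and s: "s \<in> P" and c: "0 \<le> c"
    and le: "\<And>i. penalty i x < 1 \<Longrightarrow> f (a i) s - penalty i x \<le> c"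
  shows "envelope x s \<le> c"
proof -
  have "max 0 (f (a i) s - penalty i x) \<le> c" for i
    using le[of i] c realization_points_bounds[OF f_in[OF a_in[of i]] s] by (cases "penalty i x < 1") auto
  then have "(SUP i. max 0 (f (a i) s - penalty i x)) \<le> c"
    by (intro cSUP_least) auto
  then show ?thesis using x by (simp add: envelope_def)
qed

lemma envelope_in_unit_interval:
  assumes "x \<in> M" "s \<in> P"
  shows "0 \<le> envelope x s" "envelope x s \<le> 1"
proof -
  have "0 \<le> envelope x s \<and> envelope x s \<le> 1"
  proof (cases "x \<in> A")
    case True
    then show ?thesis using realization_points_bounds[OF f_in assms(2)] by (simp add: envelope_def)
  next
    case False
    have "f (a i) s - penalty i x \<le> 1" for i
      using realization_points_bounds[OF f_in[OF a_in[of i]] assms(2)] penalty_nonneg[OF assms(1), of i] by simp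
    then show ?thesis
      using envelope_upper[OF assms(1) False assms(2), of 0] envelope_least[OF assms(1) False assms(2), of 1] by simp
  qed
  then show "0 \<le> envelope x s" "envelope x s \<le> 1" by auto
qed

text \<open>Past an index \<open>k\<close> with \<open>a k\<close> within \<open>2 * D x\<close> all
  penalties are at least 1. So every value is 0 or comes from a shift of the finite image of some
  \<open>f (a i)\<close> with \<open>i \<le> k\<close>.\<close>

lemma finite_envelope_image:
  assumes x: "x \<in> M"
  shows "finite (envelope x ` P)"
proof (cases "x \<in> A")
  case True
  have "envelope x ` P = f x ` P" using True by (simp add: envelope_def)
  then show ?thesis using f_in[OF True] by (simp add: realization_points_iff)
next
  case False
  obtain k where k: "d x (a k) < 2 * D x"
    using D_near[OF x, of "2 * D x"] D_pos[OF x False] by auto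
  have pen: "1 \<le> penalty i x" if "k < i" for i
    using penalty_less_1(2)[OF x False _ that] k by force
  have "envelope x s \<in> insert 0 (\<Union>i\<le>k. (\<lambda>c. c - penalty i x) ` f (a i) ` P)" if s: "s \<in> P" for s
  proof -
    let ?g = "\<lambda>i. max 0 (f (a i) s - penalty i x)"
    have sub: "?g i \<in> insert 0 ((\<lambda>i. f (a i) s - penalty i x) ` {..k})" for i
    proof (cases "k < i")
      case True
      then have "?g i = 0" using pen[OF True] realization_points_bounds[OF f_in[OF a_in[of i]] s] by simp
      then show ?thesis by simp
    next
      case False
      then show ?thesis by (simp add: max_def)
    qed
    then have fin: "finite (range ?g)"
      by (meson finite.insertI finite_atMost finite_imageI finite_subset image_subsetI)
    then have "envelope x s = Max (range ?g)" using False by (simp add: envelope_def cSup_eq_Max)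
    then have "envelope x s \<in> range ?g" using Max_in[OF fin] by simp
    then obtain i where "envelope x s = ?g i" by blast
    then show ?thesis using sub[of i] s by auto
  qed
  then have "envelope x ` P \<subseteq> insert 0 (\<Union>i\<le>k. (\<lambda>c. c - penalty i x) ` f (a i) ` P)" by blast
  moreover have "finite (insert 0 (\<Union>i\<le>k. (\<lambda>c. c - penalty i x) ` f (a i) ` P))"
    using f_in[OF a_in] by (simp add: realization_points_iff)
  ultimately show ?thesis by (rule finite_subset)
qed

text \<open>Off \<open>A\<close>, take \<open>b = a k\<close> within \<open>2 * D x\<close>.
  Contributing points lie within \<open>4 * D x\<close>, hence the upper error
  \<open>(4 + 2) * D x\<close>; an unpenalized point within \<open>3 * D x\<close> gives the lower
  error \<open>(3 + 2) * D x\<close>.\<close>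

lemma envelope_close:
  assumes x: "x \<in> M"
  obtains b where "b \<in> A" "d x b \<le> 2 * D x"
    "\<And>s. s \<in> P \<Longrightarrow> \<bar>envelope x s - f b s\<bar> \<le> 6 * D x"
proof (cases "x \<in> A")
  case True
  then show ?thesis
    using x by (intro that[of x]) (auto simp: d_zero D_nonneg envelope_def)
next
  case False
  note pos = D_pos[OF x False]
  obtain k where k: "d x (a k) < 2 * D x"
    using D_near[OF x, of "2 * D x"] pos by auto
  have near: "f (a i) s \<le> f (a j) s + d x (a i) + d x (a j)" if "s \<in> P" for s i j
    using f_lipschitz[OF a_in[of i] a_in[of j] that] d_triangle[OF a_in_M[of i] x a_in_M[of j]]
      d_commute[OF x a_in_M[of i]] by linarith
  show ?thesis
  proof (rule that[of "a k"])
    fix s assume s: "s \<in> P"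
    have "envelope x s \<le> f (a k) s + 6 * D x"
    proof (rule envelope_least[OF x False s])
      show "0 \<le> f (a k) s + 6 * D x"
        using pos realization_points_bounds[OF f_in[OF a_in[of k]] s] by simp
      fix i assume "penalty i x < 1"
      from penalty_less_1(1)[OF x False this]
      show "f (a i) s - penalty i x \<le> f (a k) s + 6 * D x"
        using near[OF s, of i k] k penalty_nonneg[OF x, of i] by linarith
    qed
    moreover have "f (a k) s \<le> envelope x s + 6 * D x"
    proof -
      obtain i where "penalty i x = 0" "d x (a i) < 3 * D x" using penalty_eq_0[OF x False] by blast
      then show ?thesis
        using near[OF s, of k i] k envelope_upper[OF x False s, of i] pos by linarith
    qed
    ultimately show "\<bar>envelope x s - f (a k) s\<bar> \<le> 6 * D x" by linarith
  qed (use k a_in in auto)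
qed

text \<open>At each of \<open>x\<close> and \<open>y\<close>, passing to a value of \<open>f\<close>
  costs \<open>6 * D\<close> and moving its argument costs \<open>2 * D\<close>. Useful where
  \<open>D\<close> is small.\<close>

lemma envelope_le_add_near:
  assumes "x \<in> M" "y \<in> M" "s \<in> P"
  shows "envelope x s \<le> envelope y s + (8 * D x + 8 * D y + d x y)"
proof -
  obtain b where b: "b \<in> A" "d x b \<le> 2 * D x" "\<bar>envelope x s - f b s\<bar> \<le> 6 * D x"
    using envelope_close[OF assms(1)] assms(3) by metis
  obtain c where c: "c \<in> A" "d y c \<le> 2 * D y" "\<bar>envelope y s - f c s\<bar> \<le> 6 * D y"
    using envelope_close[OF assms(2)] assms(3) by metis
  have M: "b \<in> M" "c \<in> M" using b c A_subset by auto
  have "d b c \<le> d x b + d x y + d y c"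
    using d_triangle[OF M(1) assms(1) M(2)] d_triangle[OF assms(1,2) M(2)] d_commute[OF assms(1) M(1)]
    by linarith
  then show ?thesis
    using f_lipschitz[OF b(1) c(1) assms(3)] b c by linarith
qed

text \<open>For a term that contributes at \<open>x\<close>, the penalty at \<open>y\<close> is
  larger by at most \<open>5 * d x y / D y\<close>. Useful where \<open>D\<close> is bounded away
  from 0.\<close>

lemma envelope_le_add_far:
  assumes x: "x \<in> M" "x \<notin> A" and y: "y \<in> M" "y \<notin> A" and s: "s \<in> P"
  shows "envelope x s \<le> envelope y s + 5 * d x y / D y"
proof (rule envelope_least[OF x s])
  show "0 \<le> envelope y s + 5 * d x y / D y"
    using envelope_in_unit_interval[OF y(1) s] D_pos[OF y] d_nonneg[OF x(1) y(1)] by simp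
  fix i assume "penalty i x < 1"
  then have "penalty i y \<le> penalty i x + 5 * d x y / D y"
    by (intro penalty_le_add[OF x y]) simp
  then show "f (a i) s - penalty i x \<le> envelope y s + 5 * d x y / D y"
    using envelope_upper[OF y s, of i] by linarith
qed

lemma envelope_uniformly_continuous:
  assumes \<epsilon>: "0 < \<epsilon>"
  obtains \<delta> where "0 < \<delta>"
    "\<And>x y s. x \<in> M \<Longrightarrow> y \<in> M \<Longrightarrow> s \<in> P \<Longrightarrow> d x y < \<delta> \<Longrightarrow> envelope x s \<le> envelope y s + \<epsilon>"
proof
  \<comment> \<open>\<open>?\<eta>\<close> separates the two regimes. If
    \<open>D y < ?\<eta>\<close>, then \<open>D x < 3/2 * ?\<eta>\<close> and the near bound is
    below \<open>21 * ?\<eta>\<close>; otherwise \<open>?\<delta>\<close> keeps \<open>D x\<close>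
    positive and the far bound at most \<open>\<epsilon>\<close>.\<close>
  let ?\<eta> = "\<epsilon> / 32"
  let ?\<delta> = "min (?\<eta> / 2) (\<epsilon> * ?\<eta> / 5)"
  show "0 < ?\<delta>" using \<epsilon> by simp
  fix x y s assume x: "x \<in> M" and y: "y \<in> M" and s: "s \<in> P" and xy: "d x y < ?\<delta>"
  note D = D_lipschitz[OF x y] D_lipschitz[OF y x] d_commute[OF x y]
  show "envelope x s \<le> envelope y s + \<epsilon>"
  proof (cases "D y < ?\<eta>")
    case True
    then have "8 * D x + 8 * D y + d x y \<le> \<epsilon>" using D xy by linarith
    then show ?thesis using envelope_le_add_near[OF x y s] by linarith
  next
    case False
    then have "0 < D x" "0 < D y" using D xy \<epsilon> by linarith+
    then have "x \<notin> A" "y \<notin> A" using D_zero_iff x y by fastforce+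
    moreover have "5 * d x y / D y \<le> \<epsilon>"
    proof -
      have "5 * d x y \<le> \<epsilon> * ?\<eta>" using xy by linarith
      also have "\<dots> \<le> \<epsilon> * D y" using False \<epsilon> by (intro mult_left_mono) auto
      finally show ?thesis using \<open>0 < D y\<close> by (simp add: pos_divide_le_eq)
    qed
    ultimately show ?thesis using envelope_le_add_far[OF x _ y _ s] by force
  qed
qed

section \<open>Stretching about 1/2\<close>

lemma stretched_le_add:
  assumes x: "x \<in> M" "D x \<le> 1/24" and y: "y \<in> M" and s: "s \<in> P"
    and le: "envelope x s \<le> envelope y s + c" "0 \<le> c"
  shows "stretched x s \<le> stretched y s + (2 * c + 12 * d x y)"
proof -
  let ?u = "envelope x s" and ?v = "envelope y s"
  note v = envelope_in_unit_interval[OF y s]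
  \<comment> \<open>At fixed \<open>D x\<close> the stretching has slope
    \<open>1 + 24 * D x\<close>, at most 2 by the bound \<open>1/24\<close>.\<close>
  have "(?u - ?v) * (1 + 24 * D x) \<le> c * (1 + 24 * D x)"
    using le(1) D_nonneg[OF x(1)] by (intro mult_right_mono) auto
  also have "\<dots> \<le> c * 2"
    using le(2) x(2) by (intro mult_left_mono) auto
  finally have "(?u - ?v) * (1 + 24 * D x) \<le> c * 2" .
  \<comment> \<open>At fixed envelope value \<open>?v\<close> the slope in \<open>D\<close> is
    \<open>12 * (2 * ?v - 1)\<close>, between -12 and 12.\<close>
  moreover have "(D x - D y) * (24 * ?v - 12) \<le> 12 * d x y"
  proof -
    have "\<bar>D x - D y\<bar> \<le> d x y"
      using D_lipschitz[OF x(1) y] D_lipschitz[OF y x(1)] d_commute[OF x(1) y] by linarith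
    moreover have "\<bar>24 * ?v - 12\<bar> \<le> 12" using v by linarith
    ultimately have "\<bar>D x - D y\<bar> * \<bar>24 * ?v - 12\<bar> \<le> d x y * 12"
      by (intro mult_mono) auto
    then show ?thesis by (simp add: abs_mult[symmetric])
  qed
  moreover have "?u + 12 * D x * (2 * ?u - 1) - (?v + 12 * D y * (2 * ?v - 1)) =
      (?u - ?v) * (1 + 24 * D x) + (D x - D y) * (24 * ?v - 12)"
    by (simp add: algebra_simps)
  ultimately have "?u + 12 * D x * (2 * ?u - 1) \<le> ?v + 12 * D y * (2 * ?v - 1) + (2 * c + 12 * d x y)"
    by linarith
  then show ?thesis
    using s le(2) d_nonneg[OF x(1) y] by (simp only: stretched_def restrict_apply if_True clamp_le_add)
qed

lemma stretched_tame:
  assumes x: "x \<in> M" "D x \<le> 1/24"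
  shows "tame (stretched x)"
  unfolding tame_def
proof (intro conjI allI impI)
  show "stretched x ` P \<subseteq> {0..1}" by (auto simp: stretched_def)
  have "stretched x ` P = (\<lambda>u. min 1 (max 0 (u + 12 * D x * (2 * u - 1)))) ` envelope x ` P"
    by (auto simp: stretched_def image_image)
  then show "finite (stretched x ` P)" using finite_envelope_image[OF x(1)] by simp
  fix t :: real assume t: "0 < t" "t \<le> 1"
  obtain b where b: "b \<in> A" "\<And>s. s \<in> P \<Longrightarrow> \<bar>envelope x s - f b s\<bar> \<le> 6 * D x"
    using envelope_close[OF x(1)] by metis
  \<comment> \<open>The error of \<open>envelope_close\<close>. Before clamping, the stretching is
    \<open>(1 + 4 * h) * u - 2 * h\<close>, and \<open>D x \<le> 1/24\<close> means
    \<open>h \<le> 1/4\<close>.\<close>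
  define h where "h = 6 * D x"
  have h: "0 \<le> h" "h \<le> 1/4" using x D_nonneg[OF x(1)] by (auto simp: h_def)
  have st: "stretched x s = min 1 (max 0 (envelope x s + 2 * h * (2 * envelope x s - 1)))" if "s \<in> P" for s
    using that by (simp add: stretched_def h_def)
  \<comment> \<open>Where \<open>f b\<close> is 1 the envelope is at least \<open>1 - h\<close>,
    which is sent to at least \<open>1 + h * (1 - 4 * h) \<ge> 1\<close>.\<close>
  show "superlevel P (stretched x) t \<noteq> {}"
  proof -
    obtain p where p: "p \<in> P" "superlevel P (f b) 1 = down p"
      using superlevel_realization_point[OF f_in[OF b(1)], of 1] by auto
    then have "p \<in> superlevel P (f b) 1" using order_refl by (auto simp: down_def)
    then have "1 - h \<le> envelope x p"
      using b(2)[OF p(1)] by (auto simp: superlevel_def h_def)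
    then have "(1 - h) * (1 + 4 * h) \<le> envelope x p * (1 + 4 * h)"
      using h by (intro mult_right_mono) auto
    moreover have "1 + 2 * h \<le> (1 - h) * (1 + 4 * h)"
      using mult_left_mono[OF h(2) h(1)] by (simp add: algebra_simps)
    ultimately have "1 \<le> envelope x p + 2 * h * (2 * envelope x p - 1)"
      by (simp add: algebra_simps)
    then have "p \<in> superlevel P (stretched x) t"
      using t p(1) st[OF p(1)] by (simp add: superlevel_def)
    then show ?thesis by blast
  qed
  \<comment> \<open>Level \<open>t / 2\<close> is positive, so its superlevel set for
    \<open>f b\<close> is principal. Off that set the envelope is below \<open>t / 2 + h\<close>,
    which is stretched to less than
    \<open>t / 2 + 2 * h * t - h + 4 * h * h \<le> t\<close>.\<close>
  have "superlevel P (stretched x) t \<subseteq> superlevel P (f b) (t / 2)"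
  proof
    fix s assume "s \<in> superlevel P (stretched x) t"
    then have s: "s \<in> P" "t \<le> envelope x s + 2 * h * (2 * envelope x s - 1)"
      using st t by (auto simp: superlevel_def min_def max_def split: if_splits)
    have "t / 2 \<le> f b s"
    proof (rule ccontr)
      assume "\<not> t / 2 \<le> f b s"
      then have "envelope x s < t / 2 + h" using b(2)[OF s(1)] by (simp add: h_def)
      then have "envelope x s * (1 + 4 * h) < (t / 2 + h) * (1 + 4 * h)"
        using h by (intro mult_strict_right_mono) auto
      moreover have "h * t \<le> t / 4" "h * h \<le> h / 4"
        using mult_right_mono[OF h(2), of t] mult_left_mono[OF h(2) h(1)] t by auto
      ultimately show False using s(2) by (simp add: algebra_simps)
    qed
    then show "s \<in> superlevel P (f b) (t / 2)" using s by (simp add: superlevel_def)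
  qed
  moreover obtain p where "p \<in> P" "superlevel P (f b) (t / 2) = down p"
    using superlevel_realization_point[OF f_in[OF b(1)], of "t / 2"] t by auto
  ultimately show "\<exists>p\<in>P. superlevel P (stretched x) t \<subseteq> down p" by blast
qed

section \<open>The extension and its uniform continuity\<close>

lemma extension_in_realization_points:
  "x \<in> M \<Longrightarrow> D x \<le> 1/24 \<Longrightarrow> extension x \<in> realization_points P r"
  unfolding extension_def by (intro realize_in_realization_points stretched_tame)

text \<open>On \<open>A\<close> the distance \<open>D\<close> vanishes, so stretching changes
  nothing, and \<open>realize\<close> fixes the realization.\<close>

lemma extension_eq:
  assumes "x \<in> A"
  shows "extension x = f x"
proof -
  have "D x = 0" using assms A_subset D_zero_iff by blast
  then have "stretched x s = f x s" for s
    using realization_points_bounds[OF f_in[OF assms], of s] f_in[OF assms] assms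
    by (auto simp: stretched_def envelope_def realization_points_iff PiE_iff extensional_def)
  then have "stretched x = f x" by blast
  then show ?thesis
    using realize_realization_point(2)[OF f_in[OF assms]] by (simp add: extension_def)
qed

lemma extension_uniformly_continuous:
  assumes \<epsilon>: "0 < \<epsilon>"
  obtains \<delta> where "0 < \<delta>"
    "\<And>x y s. x \<in> M \<Longrightarrow> y \<in> M \<Longrightarrow> D x \<le> 1/24 \<Longrightarrow> D y \<le> 1/24 \<Longrightarrow> s \<in> P \<Longrightarrow> d x y < \<delta> \<Longrightarrow>
      \<bar>extension x s - extension y s\<bar> \<le> \<epsilon>"
proof -
  \<comment> \<open>\<open>stretched_le_add\<close> turns \<open>\<epsilon> / 4\<close> and
    \<open>d x y < \<epsilon> / 24\<close> into
    \<open>2 * (\<epsilon> / 4) + 12 * (\<epsilon> / 24) = \<epsilon>\<close>, and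
    \<open>realize\<close> is nonexpansive.\<close>
  obtain \<delta> where \<delta>: "0 < \<delta>"
    "\<And>x y s. x \<in> M \<Longrightarrow> y \<in> M \<Longrightarrow> s \<in> P \<Longrightarrow> d x y < \<delta> \<Longrightarrow> envelope x s \<le> envelope y s + \<epsilon> / 4"
    using envelope_uniformly_continuous[of "\<epsilon> / 4"] \<epsilon> by auto
  have le: "extension x s \<le> extension y s + \<epsilon>"
    if "x \<in> M" "y \<in> M" "D x \<le> 1/24" "D y \<le> 1/24" "s \<in> P" "d x y < min \<delta> (\<epsilon> / 24)" for x y s
    unfolding extension_def
  proof (rule realize_le_add[OF stretched_tame stretched_tame])
    fix q assume q: "q \<in> P"
    have "stretched x q \<le> stretched y q + (2 * (\<epsilon> / 4) + 12 * d x y)"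
      using that q \<epsilon> by (intro stretched_le_add \<delta>(2)) auto
    then show "stretched x q \<le> stretched y q + \<epsilon>" using that(6) by simp
  qed (use that \<epsilon> in auto)
  show ?thesis
  proof (rule that[of "min \<delta> (\<epsilon> / 24)"])
    fix x y s
    assume H: "x \<in> M" "y \<in> M" "D x \<le> 1/24" "D y \<le> 1/24" "s \<in> P" "d x y < min \<delta> (\<epsilon> / 24)"
    show "\<bar>extension x s - extension y s\<bar> \<le> \<epsilon>"
      using le[OF H] le[of y x s] H d_commute[OF H(1,2)] by (simp add: abs_le_iff)
  qed (use \<delta> \<epsilon> in auto)
qed

end

subsection \<open>Uniform retraction\<close>

text \<open>Supplies the sequence for \<open>concave_modulus\<close>; the cap at 1 makes the new
  distance dominate the metric.\<close>

lemma uniformly_continuous_map_moduli: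
  assumes "uniformly_continuous_map X Y g"
  obtains \<delta> :: "nat \<Rightarrow> real" where "\<And>n. 0 < \<delta> n" "\<And>n. \<delta> n \<le> 1"
    "\<And>n x y. x \<in> mspace X \<Longrightarrow> y \<in> mspace X \<Longrightarrow> mdist X x y < \<delta> n \<Longrightarrow>
      mdist Y (g x) (g y) < 1 / real (Suc n)"
proof -
  have "\<exists>\<delta>. 0 < \<delta> \<and> \<delta> \<le> 1 \<and> (\<forall>x\<in>mspace X. \<forall>y\<in>mspace X. mdist X x y < \<delta> \<longrightarrow>
      mdist Y (g x) (g y) < 1 / real (Suc n))" for n
  proof -
    obtain \<delta> where "0 < \<delta>" "\<forall>x\<in>mspace X. \<forall>y\<in>mspace X. mdist X y x < \<delta> \<longrightarrow>
      mdist Y (g y) (g x) < 1 / real (Suc n)"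
      using assms unfolding uniformly_continuous_map_def
      by (metis of_nat_0_less_iff zero_less_Suc zero_less_divide_1_iff)
    then show ?thesis by (intro exI[of _ "min 1 \<delta>"]) auto
  qed
  then show ?thesis using that by metis
qed

context conditionally_complete_poset
begin

lemma retraction_onto_embedded_realization:
  fixes X :: "'x metric" and e
  assumes "countable P" "realization_points P r \<noteq> {}"
    and emb: "uniform_embedding (geometric_realization P r) X e"
    and closed: "closedin (mtopology_of X) (e ` realization_points P r)"
  shows "\<exists>N \<rho>. uniform_neighborhood X (e ` realization_points P r) N \<and>
    uniform_retraction X N (e ` realization_points P r) \<rho>"
proof -
  let ?GR = "geometric_realization P r" and ?R = "realization_points P r"
  define A where "A = e ` ?R"
  have "P \<noteq> {}" using assms(2) by (rule realization_points_nonempty)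
  have AX: "A \<subseteq> mspace X"
    using emb by (simp add: A_def uniform_embedding_def mspace_geometric_realization)
  then have int: "A \<inter> mspace X = A" by blast
  obtain g where e: "uniformly_continuous_map ?GR (submetric X A) e"
    and g: "uniformly_continuous_map (submetric X A) ?GR g"
    and eg': "\<forall>z\<in>A \<inter> mspace X. e (g z) = z"
    using emb by (auto simp: A_def uniform_embedding_def uniform_homeomorphism_def
        mspace_geometric_realization)
  have eg: "e (g z) = z" if "z \<in> A" for z using eg' int that by simp
  have gR: "g z \<in> ?R" if "z \<in> A" for z
    using uniformly_continuous_map_funspace[OF g] that AX by (auto simp: mspace_geometric_realization)
  have e_uc: "\<exists>\<sigma>>0. \<forall>x\<in>?R. \<forall>y\<in>?R. mdist ?GR x y < \<sigma> \<longrightarrow> mdist X (e x) (e y) < c" if "0 < c" for c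
    using e that unfolding uniformly_continuous_map_def by (simp add: mspace_geometric_realization) blast
  obtain \<delta> where \<delta>: "\<And>n. 0 < \<delta> n" "\<And>n. \<delta> n \<le> 1"
    and g\<delta>: "\<And>n x y. x \<in> A \<Longrightarrow> y \<in> A \<Longrightarrow> mdist X x y < \<delta> n \<Longrightarrow> mdist ?GR (g x) (g y) < 1 / real (Suc n)"
    using uniformly_continuous_map_moduli[OF g] int by auto
  define \<omega> where "\<omega> = concave_modulus \<delta>"
  \<comment> \<open>A uniformly equivalent distance for which \<open>g\<close> is 1-Lipschitz in
    every coordinate.\<close>
  define d where "d x y = \<omega> (mdist X x y)" for x y
  have small: "\<exists>\<tau>>0. \<forall>x y. mdist X x y < \<tau> \<longrightarrow> d x y < c" if "0 < c" for c
    using concave_modulus_tendsto_0[of \<delta> c] \<delta> that unfolding d_def \<omega>_def by (metis mdist_nonneg)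
  obtain b :: "nat \<Rightarrow> 'a \<Rightarrow> real" where "range b \<subseteq> ?R \<and> (\<forall>y\<in>?R. \<forall>c>0. \<exists>i. mdist ?GR (b i) y < c)"
    using realization_separable[OF assms(1,2)] by (rule exE)
  then have b: "range b \<subseteq> ?R" "\<And>y c. y \<in> ?R \<Longrightarrow> 0 < c \<Longrightarrow> \<exists>i. mdist ?GR (b i) y < c"
    by auto
  have d_ge: "mdist X x y \<le> d x y" for x y
    using concave_modulus_ge[of \<delta> "mdist X x y"] \<delta> by (simp add: d_def \<omega>_def)
  then have d_nonneg: "0 \<le> d x y" for x y
    by (meson mdist_nonneg order.trans)
  interpret ext: realization_extension P r "mspace X" d A "\<lambda>i. e (b i)" g
  proof
    show "d x x = 0" if "x \<in> mspace X" for x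
    proof -
      have "mdist X x x = 0"
        using Metric_space.zero[OF Metric_space_mspace_mdist that that] by simp
      then show ?thesis using concave_modulus_0[OF \<delta>] by (simp add: d_def \<omega>_def)
    qed
    show "d x y = d y x" for x y by (simp add: d_def mdist_commute)
    show "d x z \<le> d x y + d y z" if "x \<in> mspace X" "y \<in> mspace X" "z \<in> mspace X" for x y z
    proof -
      have "d x z \<le> \<omega> (mdist X x y + mdist X y z)"
        using concave_modulus_mono[of \<delta>] \<delta> mdist_triangle[OF that] by (simp add: d_def \<omega>_def)
      also have "\<dots> \<le> d x y + d y z"
        using concave_modulus_subadditive[of \<delta>] \<delta> by (simp add: d_def \<omega>_def)
      finally show ?thesis .
    qed
    show "e (b i) \<in> A" for i using b(1) by (auto simp: A_def)
    show "g x s \<le> g y s + d x y" if xy: "x \<in> A" "y \<in> A" and s: "s \<in> P" for x y s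
    proof -
      have "g x s - g y s \<le> 1 / real (Suc n) + mdist X x y / \<delta> n" for n
      proof (cases "mdist X x y < \<delta> n")
        case True
        have "g x s - g y s \<le> 1 / real (Suc n)"
          using g\<delta>[OF xy True] abs_diff_le_mdist_realization[OF gR[OF xy(1)] gR[OF xy(2)] s] by linarith
        moreover have "0 \<le> mdist X x y / \<delta> n" using \<delta>(1)[of n] by simp
        ultimately show ?thesis by linarith
      next
        case False
        then have "1 \<le> mdist X x y / \<delta> n" using \<delta>(1)[of n] by (simp add: pos_le_divide_eq)
        moreover have "g x s - g y s \<le> 1"
          using realization_points_bounds[OF gR[OF xy(1)] s] realization_points_bounds[OF gR[OF xy(2)] s]
          by linarith
        moreover have "0 \<le> 1 / real (Suc n)" by simp
        ultimately show ?thesis by linarith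
      qed
      then have "g x s - g y s \<le> d x y"
        unfolding d_def \<omega>_def by (rule concave_modulus_greatest[OF \<delta>])
      then show ?thesis by simp
    qed
    \<comment> \<open>If \<open>x \<in> A\<close>, approximate \<open>g x\<close> by some
      \<open>b i\<close> and use uniform continuity of \<open>e\<close>. Conversely, a point off the
      closed set \<open>A\<close> has a metric ball missing \<open>A\<close>, and \<open>d\<close>
      dominates the metric.\<close>
    show "(INF i. d x (e (b i))) = 0 \<longleftrightarrow> x \<in> A" if x: "x \<in> mspace X" for x
    proof
      have bdd: "bdd_below (range (\<lambda>i. d x (e (b i))))"
        using d_nonneg by (intro bdd_belowI2[of _ 0])
      assume "x \<in> A"
      have "(INF i. d x (e (b i))) \<le> c" if c: "0 < c" for c
      proof -
        obtain \<tau> where \<tau>: "0 < \<tau>" "\<forall>x y. mdist X x y < \<tau> \<longrightarrow> d x y < c" using small[OF c] by blast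
        obtain \<sigma> where \<sigma>: "0 < \<sigma>" "\<forall>x\<in>?R. \<forall>y\<in>?R. mdist ?GR x y < \<sigma> \<longrightarrow> mdist X (e x) (e y) < \<tau>"
          using e_uc[OF \<tau>(1)] by blast
        obtain i where i: "mdist ?GR (b i) (g x) < \<sigma>" using b(2)[OF gR[OF \<open>x \<in> A\<close>] \<sigma>(1)] by blast
        have "mdist X (e (b i)) (e (g x)) < \<tau>"
          using \<sigma>(2) i b(1) gR[OF \<open>x \<in> A\<close>] by blast
        then have "d x (e (b i)) < c" using \<tau>(2) eg[OF \<open>x \<in> A\<close>] by (simp add: mdist_commute)
        then show ?thesis using cINF_lower[OF bdd, of i] by simp
      qed
      then have "(INF i. d x (e (b i))) \<le> 0" by (rule field_le_epsilon[where y=0, simplified])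
      moreover have "0 \<le> (INF i. d x (e (b i)))" using d_nonneg by (intro cINF_greatest) auto
      ultimately show "(INF i. d x (e (b i))) = 0" by simp
    next
      assume inf: "(INF i. d x (e (b i))) = 0"
      show "x \<in> A"
      proof (rule ccontr)
        assume "x \<notin> A"
        interpret X: Metric_space "mspace X" "mdist X" by simp
        obtain \<epsilon> where \<epsilon>: "0 < \<epsilon>" "disjnt A (X.mball x \<epsilon>)"
          using closed x \<open>x \<notin> A\<close> unfolding mtopology_of_def X.closedin_metric A_def by blast
        have "\<epsilon> \<le> d x (e (b i))" for i
        proof -
          have "e (b i) \<in> A" using b(1) by (auto simp: A_def)
          then have "\<epsilon> \<le> mdist X x (e (b i))"
            using \<epsilon>(2) x AX by (auto simp: disjnt_iff not_less)
          then show ?thesis using d_ge[of x "e (b i)"] by linarith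
        qed
        then have "\<epsilon> \<le> (INF i. d x (e (b i)))" by (intro cINF_greatest) auto
        then show False using inf \<epsilon>(1) by simp
      qed
    qed
  qed (use d_nonneg AX gR in auto)
  \<comment> \<open>Below this threshold stretched functions are tame. \<open>ext.D\<close> vanishes
    on \<open>A\<close> and is 1-Lipschitz for \<open>d\<close>, so \<open>N\<close> is a uniform
    neighborhood.\<close>
  define N where "N = {x \<in> mspace X. ext.D x \<le> 1/24}"
  have D0: "ext.D x = 0" if "x \<in> A" for x using ext.D_zero_iff that AX by blast
  have extR: "ext.extension x \<in> ?R" if "x \<in> N" for x
    using ext.extension_in_realization_points that by (simp add: N_def)
  have "uniform_neighborhood X A N"
    unfolding uniform_neighborhood_def
  proof
    obtain \<tau> where \<tau>: "0 < \<tau>" "\<forall>x y. mdist X x y < \<tau> \<longrightarrow> d x y < 1/24" using small[of "1/24"] by auto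
    have "x \<in> N" if "x \<in> mspace X" "z \<in> A" "mdist X z x < \<tau>" for x z
    proof -
      have "d x z < 1/24" using \<tau>(2) that(3) by (simp add: mdist_commute)
      then show ?thesis
        using ext.D_lipschitz[of x z] D0[OF that(2)] that AX by (auto simp: N_def)
    qed
    then show "\<exists>\<epsilon>>0. \<forall>x\<in>mspace X. (\<exists>a\<in>A. mdist X a x < \<epsilon>) \<longrightarrow> x \<in> N"
      using \<tau>(1) by blast
  qed (simp add: N_def)
  moreover have "uniform_retraction X N A (\<lambda>x. e (ext.extension x))"
    unfolding uniform_retraction_def
  proof (intro conjI ballI)
    show "A \<subseteq> N" using D0 AX by (auto simp: N_def)
    show "e (ext.extension x) = x" if "x \<in> A" for x
      using that eg by (simp add: ext.extension_eq)
    show "uniformly_continuous_map (submetric X N) (submetric X A) (\<lambda>x. e (ext.extension x))"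
      unfolding uniformly_continuous_map_def
    proof (intro conjI allI impI)
      show "(\<lambda>x. e (ext.extension x)) \<in> mspace (submetric X N) \<rightarrow> mspace (submetric X A)"
        using extR AX by (auto simp: A_def)
      fix c :: real assume "0 < c"
      then obtain \<sigma> where \<sigma>: "0 < \<sigma>" "\<forall>x\<in>?R. \<forall>y\<in>?R. mdist ?GR x y < \<sigma> \<longrightarrow> mdist X (e x) (e y) < c"
        using e_uc by blast
      \<comment> \<open>The coordinatewise bound \<open>\<sigma> / 2\<close> passes to the supremum
        and leaves it strictly below \<open>\<sigma>\<close>.\<close>
      obtain \<kappa> where \<kappa>: "0 < \<kappa>" "\<And>x y s. x \<in> mspace X \<Longrightarrow> y \<in> mspace X \<Longrightarrow> ext.D x \<le> 1/24 \<Longrightarrow>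
          ext.D y \<le> 1/24 \<Longrightarrow> s \<in> P \<Longrightarrow> d x y < \<kappa> \<Longrightarrow>
          \<bar>ext.extension x s - ext.extension y s\<bar> \<le> \<sigma> / 2"
        using ext.extension_uniformly_continuous[of "\<sigma> / 2"] \<sigma>(1) by auto
      obtain \<tau> where \<tau>: "0 < \<tau>" "\<forall>x y. mdist X x y < \<tau> \<longrightarrow> d x y < \<kappa>" using small[OF \<kappa>(1)] by blast
      have "mdist X (e (ext.extension y)) (e (ext.extension x)) < c"
        if "x \<in> N" "y \<in> N" "mdist X y x < \<tau>" for x y
      proof -
        have "mdist ?GR (ext.extension y) (ext.extension x) \<le> \<sigma> / 2"
          using that \<tau>(2) \<open>P \<noteq> {}\<close>
          by (intro mdist_realization_le extR \<kappa>(2)) (auto simp: N_def)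
        then show ?thesis using \<sigma> extR that by auto
      qed
      then show "\<exists>\<delta>>0. \<forall>x\<in>mspace (submetric X N). \<forall>y\<in>mspace (submetric X N).
          mdist (submetric X N) y x < \<delta> \<longrightarrow>
          mdist (submetric X A) (e (ext.extension y)) (e (ext.extension x)) < c"
        using \<tau>(1) by auto
    qed
  qed
  ultimately show ?thesis unfolding A_def by blast
qed

end

theorem theorem3:
  fixes P :: "'a set" and r :: "'a rel"
  assumes "partial_order_on P r"
    and "countable P"
    and "conditionally_complete_on P r"
  shows "uniform_ANR TYPE('x) (geometric_realization P r)"
proof -
  interpret conditionally_complete_poset P r
    by unfold_locales (rule assms)+
  have "\<exists>N \<rho>. uniform_neighborhood X (e ` realization_points P r) N \<and>
      uniform_retraction X N (e ` realization_points P r) \<rho>"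
    if "uniform_embedding (geometric_realization P r) X e"
      "closedin (mtopology_of X) (e ` realization_points P r)" for X :: "'x metric" and e
  proof (cases "realization_points P r = {}")
    \<comment> \<open>An empty image contains no sequence of points, but the empty set is a uniform
      neighborhood of itself.\<close>
    case True
    have "uniform_neighborhood X {} {}"
      by (auto simp: uniform_neighborhood_def intro: exI[of _ 1])
    moreover have "uniform_retraction X {} {} id"
      by (auto simp: uniform_retraction_def uniformly_continuous_map_def intro: exI[of _ 1])
    ultimately show ?thesis using True by auto
  next
    case False
    then show ?thesis using retraction_onto_embedded_realization assms(2) that by blast
  qed
  then show ?thesis
    by (simp add: uniform_ANR_def mspace_geometric_realization)
qed

end
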